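(* Let $E$ and $F$ be Banach function lattices, over $\sigma$-finite measure spaces $(\Omega,\mu)$ and $(\widetilde\Omega,\nu)$ respectively, with the weak Fatou property. Suppose $T':F'\to E'$ is the Köthe dual of a bounded linear operator $T:E\to F$ and let $(T')^*$ be the maximal operator based on $T'$ associated to a filtration of $\widetilde\Omega$. (i) If there exist $1\le p<q\le\infty$ such that $\ell_{(p),2}(E)\,u^{(q),2}(F)<2^{\frac1p-\frac1q}$, then $\|(T')^*\|_{F'\to E'}\le C\|T'\|_{F'\to E'}$ for some constant $C$ depending only on $p$, $q$, $E$ and $F$. (ii) If there exist $1\le p<q\le\infty$ such that $E$ satisfies a lower $p$-estimate and $F$ satisfies an upper $q$-estimate, then \[ \|(T')^*\|_{F'\to E'}\le\frac{2^{1/p'}}{1-(2^{q'/p'}-1)^{1/q'}}\,\ell_{(p)}(E)\,u^{(q)}(F)\,\|T'\|_{F'\to E'}. \]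
   Context: Measure spaces are complete and $\sigma$-finite; $L^0_\mu$ is the space of (classes of) measurable functions finite $\mu$-a.e. A Banach function lattice over $\Omega$ is a Banach space $E\subset L^0_\mu$ such that $f\in E$, $g\in L^0_\mu$, $|g|\le|f|$ a.e. imply $g\in E$ and $\|g\|_E\le\|f\|_E$. $E$ has the weak Fatou property if for every $f\in E$: whenever $0\le f_j\in E$ increases to $f$ pointwise a.e., then $\|f_j\|_E\to\|f\|_E$. The Köthe dual $E'$ is the space of $g\in L^0_\mu$ with $\|g\|_{E'}=\sup\{\int_\Omega|fg|\,d\mu:\|f\|_E\le1\}<\infty$. A linear map $T':F'\to E'$ is the Köthe dual of a bounded linear $T:E\to F$ if $\int_{\widetilde\Omega}g\,Tf\,d\nu=\int_\Omega f\,T'g\,d\mu$ for all $f\in E$, $g\in F'$. For a lattice $X$, $0<p\le\infty$, $n\in\mathbb N$: $u^{(p),n}(X)$ is the least $C$ such that $\|\sum_{j=1}^n x_j\|_X\le C(\sum_{j=1}^n\|x_j\|_X^p)^{1/p}$ for all disjointly supported $x_1,\dots,x_n\in X$; $\ell_{(p),n}(X)$ is the least $C$ such that $(\sum_{j=1}^n\|x_j\|_X^p)^{1/p}\le C\|\sum_{j=1}^n x_j\|_X$ for all such $x_j$ (maximum in place of $p$-sum when $p=\infty$). $X$ satisfies an upper (lower) $p$-estimate if $u^{(p)}(X)=\sup_nu^{(p),n}(X)<\infty$ (respectively $\ell_{(p)}(X)=\sup_n\ell_{(p),n}(X)<\infty$). Here $1/p+1/p'=1$ and $1/\infty=0$.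 A filtration of $\widetilde\Omega$ is a family $\{A_\alpha:\alpha\in Q\}$ of measurable subsets of $\widetilde\Omega$ indexed by a countable totally ordered set $Q$ with $A_\alpha\subset A_{\alpha'}$ whenever $\alpha<\alpha'$. The maximal operator based on $T'$ associated to it is $(T')^*g=\sup_{\alpha\in Q}|T'(g\chi_{A_\alpha})|$, $g\in F'$, and $\|(T')^*\|_{F'\to E'}$ is the least $K$ with $\|(T')^*g\|_{E'}\le K\|g\|_{F'}$ for all $g$. *)

theory Defs
  imports "HOL-Analysis.Analysis"
begin

text \<open>
  Conventions. The scalars are a type \<open>'k\<close> of sort
  \<open>{real_normed_field, banach, second_countable_topology}\<close>, which covers both the real
  and the complex numbers. An element of $L^0$ is represented by any of its everywhere finite
  measurable representatives; equality in $L^0$ is equality almost everywhere.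
  Exponents in $(0,\infty]$ have type \<open>ennreal\<close>, where \<open>1 / \<infinity> = 0\<close> and \<open>1 / 0 = \<infinity>\<close>.
\<close>

record ('a, 'k) function_space =
  base :: "'a measure"
  elems :: "('a \<Rightarrow> 'k) set"
  nrm :: "('a \<Rightarrow> 'k) \<Rightarrow> real"

locale banach_function_lattice =
  fixes E :: "('a, 'k::{real_normed_field, banach, second_countable_topology}) function_space"
  assumes elems_measurable: "elems E \<subseteq> borel_measurable (base E)"
    and zero_mem: "(\<lambda>x. 0) \<in> elems E"
    and add_mem: "\<And>f g. f \<in> elems E \<Longrightarrow> g \<in> elems E \<Longrightarrow> (\<lambda>x. f x + g x) \<in> elems E"
    and scale_mem: "\<And>c f. f \<in> elems E \<Longrightarrow> (\<lambda>x. c * f x) \<in> elems E"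
    and nrm_nonneg: "\<And>f. f \<in> elems E \<Longrightarrow> 0 \<le> nrm E f"
    and nrm_eq_0_iff: "\<And>f. f \<in> elems E \<Longrightarrow> nrm E f = 0 \<longleftrightarrow> (AE x in base E. f x = 0)"
    and nrm_triangle: "\<And>f g. f \<in> elems E \<Longrightarrow> g \<in> elems E \<Longrightarrow>
          nrm E (\<lambda>x. f x + g x) \<le> nrm E f + nrm E g"
    and nrm_scale: "\<And>c f. f \<in> elems E \<Longrightarrow> nrm E (\<lambda>x. c * f x) = norm c * nrm E f"
    and nrm_complete: "\<And>f :: nat \<Rightarrow> 'a \<Rightarrow> 'k. \<lbrakk>\<And>n. f n \<in> elems E;
          \<And>e. e > 0 \<Longrightarrow> \<exists>n0. \<forall>m\<ge>n0. \<forall>n\<ge>n0. nrm E (\<lambda>x. f m x - f n x) < e\<rbrakk> \<Longrightarrow>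
          \<exists>g\<in>elems E. (\<lambda>n. nrm E (\<lambda>x. f n x - g x)) \<longlonglongrightarrow> 0"
    and ideal_mem: "\<And>f g. \<lbrakk>f \<in> elems E; g \<in> borel_measurable (base E);
          AE x in base E. norm (g x) \<le> norm (f x)\<rbrakk> \<Longrightarrow> g \<in> elems E"
    and nrm_mono: "\<And>f g. \<lbrakk>f \<in> elems E; g \<in> borel_measurable (base E);
          AE x in base E. norm (g x) \<le> norm (f x)\<rbrakk> \<Longrightarrow> nrm E g \<le> nrm E f"

text \<open>
  The nonnegative functions $f_j$ are given by real valued \<open>u j\<close>, embedded into the scalars
  by \<open>of_real\<close>.
\<close>
definition weak_fatou ::
  "('a, 'k::{real_normed_field, banach, second_countable_topology}) function_space \<Rightarrow> bool" where
  "weak_fatou E \<longleftrightarrow> (\<forall>f\<in>elems E. \<forall>u :: nat \<Rightarrow> 'a \<Rightarrow> real.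
     (\<forall>j. (\<lambda>x. of_real (u j x)) \<in> elems E) \<longrightarrow>
     (AE x in base E. (\<forall>j. 0 \<le> u j x) \<and> incseq (\<lambda>j. u j x) \<and>
        (\<lambda>j. of_real (u j x)) \<longlonglongrightarrow> f x) \<longrightarrow>
     (\<lambda>j. nrm E (\<lambda>x. of_real (u j x))) \<longlonglongrightarrow> nrm E f)"

text \<open>
  The norm of the Koethe dual, extended to all functions with values in $[0,\infty]$. This is
  needed for maximal functions, which are suprema and hence a priori extended valued.
  For a scalar valued \<open>g\<close> the argument is \<open>\<lambda>x. ennreal (norm (g x))\<close>.
\<close>
definition koethe_norm_ext ::
  "('a, 'k::{real_normed_field, banach, second_countable_topology}) function_space \<Rightarrow>
   ('a \<Rightarrow> ennreal) \<Rightarrow> ennreal" where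
  "koethe_norm_ext E h =
     (SUP f\<in>{f \<in> elems E. nrm E f \<le> 1}. \<integral>\<^sup>+ x. ennreal (norm (f x)) * h x \<partial>base E)"

definition koethe_norm ::
  "('a, 'k::{real_normed_field, banach, second_countable_topology}) function_space \<Rightarrow>
   ('a \<Rightarrow> 'k) \<Rightarrow> ennreal" where
  "koethe_norm E g = koethe_norm_ext E (\<lambda>x. ennreal (norm (g x)))"

definition koethe_dual ::
  "('a, 'k::{real_normed_field, banach, second_countable_topology}) function_space \<Rightarrow>
   ('a \<Rightarrow> 'k) set" where
  "koethe_dual E = {g \<in> borel_measurable (base E). koethe_norm E g < \<infinity>}"

text \<open>
  Linear maps between subspaces of $L^0$; the second clause says that \<open>T\<close> is well defined on
  classes.
\<close>
definition linear_map_ae ::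
  "'a measure \<Rightarrow> ('a \<Rightarrow> 'k) set \<Rightarrow> 'b measure \<Rightarrow> ('b \<Rightarrow> 'k) set \<Rightarrow>
   (('a \<Rightarrow> 'k::{real_normed_field, banach, second_countable_topology}) \<Rightarrow> 'b \<Rightarrow> 'k) \<Rightarrow> bool" where
  "linear_map_ae M X N Y T \<longleftrightarrow>
     (\<forall>f\<in>X. T f \<in> Y) \<and>
     (\<forall>f\<in>X. \<forall>g\<in>X. (AE x in M. f x = g x) \<longrightarrow> (AE y in N. T f y = T g y)) \<and>
     (\<forall>f\<in>X. \<forall>g\<in>X. AE y in N. T (\<lambda>x. f x + g x) y = T f y + T g y) \<and>
     (\<forall>c. \<forall>f\<in>X. AE y in N. T (\<lambda>x. c * f x) y = c * T f y)"

definition bounded_linear_map_ae ::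
  "('a, 'k::{real_normed_field, banach, second_countable_topology}) function_space \<Rightarrow>
   ('b, 'k) function_space \<Rightarrow> (('a \<Rightarrow> 'k) \<Rightarrow> 'b \<Rightarrow> 'k) \<Rightarrow> bool" where
  "bounded_linear_map_ae E F T \<longleftrightarrow>
     linear_map_ae (base E) (elems E) (base F) (elems F) T \<and>
     (\<exists>B. \<forall>f\<in>elems E. nrm F (T f) \<le> B * nrm E f)"

definition is_koethe_dual_map ::
  "('a, 'k::{real_normed_field, banach, second_countable_topology}) function_space \<Rightarrow>
   ('b, 'k) function_space \<Rightarrow> (('a \<Rightarrow> 'k) \<Rightarrow> 'b \<Rightarrow> 'k) \<Rightarrow> (('b \<Rightarrow> 'k) \<Rightarrow> 'a \<Rightarrow> 'k) \<Rightarrow> bool" where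
  "is_koethe_dual_map E F T T' \<longleftrightarrow>
     linear_map_ae (base F) (koethe_dual F) (base E) (koethe_dual E) T' \<and>
     (\<forall>f\<in>elems E. \<forall>g\<in>koethe_dual F.
        (\<integral>y. g y * T f y \<partial>base F) = (\<integral>x. f x * T' g x \<partial>base E))"

definition disjointly_supported :: "'a measure \<Rightarrow> nat \<Rightarrow> (nat \<Rightarrow> 'a \<Rightarrow> 'k::zero) \<Rightarrow> bool" where
  "disjointly_supported M n x \<longleftrightarrow>
     (\<forall>i<n. \<forall>j<n. i \<noteq> j \<longrightarrow> (AE t in M. x i t = 0 \<or> x j t = 0))"

definition lp_sum :: "ennreal \<Rightarrow> nat \<Rightarrow> (nat \<Rightarrow> real) \<Rightarrow> real" where
  "lp_sum p n a =
     (if p = \<infinity> then Max (a ` {..<n})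
      else (\<Sum>j<n. a j powr enn2real p) powr (1 / enn2real p))"

definition upper_const_n :: "ennreal \<Rightarrow> nat \<Rightarrow>
   ('a, 'k::{real_normed_field, banach, second_countable_topology}) function_space \<Rightarrow> ennreal" where
  "upper_const_n p n X = Inf {C :: ennreal. \<forall>x :: nat \<Rightarrow> 'a \<Rightarrow> 'k.
     (\<forall>j<n. x j \<in> elems X) \<and> disjointly_supported (base X) n x \<longrightarrow>
     ennreal (nrm X (\<lambda>t. \<Sum>j<n. x j t)) \<le> C * ennreal (lp_sum p n (\<lambda>j. nrm X (x j)))}"

definition lower_const_n :: "ennreal \<Rightarrow> nat \<Rightarrow>
   ('a, 'k::{real_normed_field, banach, second_countable_topology}) function_space \<Rightarrow> ennreal" where
  "lower_const_n p n X = Inf {C :: ennreal. \<forall>x :: nat \<Rightarrow> 'a \<Rightarrow> 'k.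
     (\<forall>j<n. x j \<in> elems X) \<and> disjointly_supported (base X) n x \<longrightarrow>
     ennreal (lp_sum p n (\<lambda>j. nrm X (x j))) \<le> C * ennreal (nrm X (\<lambda>t. \<Sum>j<n. x j t))}"

definition upper_const :: "ennreal \<Rightarrow>
   ('a, 'k::{real_normed_field, banach, second_countable_topology}) function_space \<Rightarrow> ennreal" where
  "upper_const p X = (SUP n\<in>{1..}. upper_const_n p n X)"

definition lower_const :: "ennreal \<Rightarrow>
   ('a, 'k::{real_normed_field, banach, second_countable_topology}) function_space \<Rightarrow> ennreal" where
  "lower_const p X = (SUP n\<in>{1..}. lower_const_n p n X)"

definition upper_estimate :: "ennreal \<Rightarrow>
   ('a, 'k::{real_normed_field, banach, second_countable_topology}) function_space \<Rightarrow> bool" where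
  "upper_estimate p X \<longleftrightarrow> upper_const p X < \<infinity>"

definition lower_estimate :: "ennreal \<Rightarrow>
   ('a, 'k::{real_normed_field, banach, second_countable_topology}) function_space \<Rightarrow> bool" where
  "lower_estimate p X \<longleftrightarrow> lower_const p X < \<infinity>"

definition conj_exponent :: "ennreal \<Rightarrow> ennreal" where
  "conj_exponent p = 1 / (1 - 1 / p)"

lemma conj_exponent: "1 / p + 1 / conj_exponent p = 1" if "1 \<le> p"
proof -
  have "1 / p \<le> 1"
  proof (cases p)
    case (real r)
    with that have "1 \<le> r" by simp
    then have "1 / p = ennreal (1 / r)"
      using real by (simp add: divide_ennreal flip: ennreal_1)
    with \<open>1 \<le> r\<close> show ?thesis by simp
  qed simp
  then show ?thesis
    by (simp add: conj_exponent_def add_diff_inverse_ennreal one_divide_one_divide_ennreal)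
qed

text \<open>
  The index set \<open>Q\<close> carries its own order \<open>r\<close>. Since every countable totally ordered set is
  isomorphic to some set of natural numbers with a suitable order \<open>r\<close>, taking \<open>nat\<close> as index type
  loses no generality.
\<close>
definition filtration :: "'b measure \<Rightarrow> 'i set \<Rightarrow> 'i rel \<Rightarrow> ('i \<Rightarrow> 'b set) \<Rightarrow> bool" where
  "filtration N Q r A \<longleftrightarrow>
     countable Q \<and> linear_order_on Q r \<and> (\<forall>\<alpha>\<in>Q. A \<alpha> \<in> sets N) \<and>
     (\<forall>\<alpha> \<beta>. (\<alpha>, \<beta>) \<in> r \<and> \<alpha> \<noteq> \<beta> \<longrightarrow> A \<alpha> \<subseteq> A \<beta>)"

definition maximal_op ::
  "(('b \<Rightarrow> 'k::real_normed_field) \<Rightarrow> 'a \<Rightarrow> 'k) \<Rightarrow> 'i set \<Rightarrow> ('i \<Rightarrow> 'b set) \<Rightarrow>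
   ('b \<Rightarrow> 'k) \<Rightarrow> 'a \<Rightarrow> ennreal" where
  "maximal_op T' Q A g = (\<lambda>x. SUP \<alpha>\<in>Q. ennreal (norm (T' (\<lambda>y. g y * indicator (A \<alpha>) y) x)))"

text \<open>
  The norm from $F'$ to $E'$ of a (not necessarily linear) map with values in the
  $[0,\infty]$-valued functions; for a linear map \<open>T'\<close> it is applied to $g \mapsto |T'g|$.
\<close>
definition koethe_op_norm ::
  "('b, 'k::{real_normed_field, banach, second_countable_topology}) function_space \<Rightarrow>
   ('a, 'k) function_space \<Rightarrow> (('b \<Rightarrow> 'k) \<Rightarrow> 'a \<Rightarrow> ennreal) \<Rightarrow> ennreal" where
  "koethe_op_norm F E S = Inf {K :: ennreal.
     \<forall>g\<in>koethe_dual F. koethe_norm_ext E (S g) \<le> K * koethe_norm F g}"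

abbreviation koethe_op_norm_linear ::
  "('b, 'k::{real_normed_field, banach, second_countable_topology}) function_space \<Rightarrow>
   ('a, 'k) function_space \<Rightarrow> (('b \<Rightarrow> 'k) \<Rightarrow> 'a \<Rightarrow> 'k) \<Rightarrow> ennreal" where
  "koethe_op_norm_linear F E T' \<equiv> koethe_op_norm F E (\<lambda>g x. ennreal (norm (T' g x)))"

end

theory Submission
  imports Defs
begin

text \<open>
  The theorem is a Christ--Kiselev maximal inequality, proved directly for $T' : F' \to E'$. Two
  facts make duality work. An upper $q$-estimate for $F$ is a lower $q'$-estimate for $F'$
  (\<open>koethe_dual_lower_estimate_restr\<close>). The norm of $E'$ is a supremum of integrals against
  functions $f$ of $E$, and the lower $p$-estimate for $E$ controls the pieces of $f$.

  Fix $f \in E$ and $g \in F'$. To bound the integral of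
  $|f| \sup_{\alpha} |T'(g\chi_{A_\alpha})|$ for a finite chain, let $A_0$ be the first set of
  the chain that carries a fixed fraction of $g$. Sets below $A_0$ see only a small part of $g$. A
  set $A$ above $A_0$ satisfies
  $|T'(g\chi_A)| \le |T'(g\chi_{A_0})| + |T'(g\chi_{A\setminus A_0})|$, where $A\setminus A_0$
  again sees only a small part of $g$. Cutting $\Omega$ according to which alternative is larger
  cuts $f$ into two disjoint parts. Induction on the length of the chain then closes up: the gain
  from halving $g$ is a power $2^{-1/q'}$, the loss from cutting $f$ is a power $2^{1/p'}$, and
  $q' < p'$. This is \<open>chain_maximal_bound\<close>, which isolates the numerical conditions on the
  sizes of the pieces of $f$ and $g$.

  The two parts of the theorem are two choices of these sizes. For two-piece estimates the sizes
  are the norms of the pieces, each step loses both constants, and the hypothesis says exactly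
  that the loss stays below the gain (\<open>balanced_of_two_piece_estimates\<close>). For full estimates
  the powers $\|f\chi_B\|^p$ and $\|g\chi_A\|^{q'}$ are replaced by their superadditive
  envelopes, so that the constants of the estimates are not lost again at each step, and the
  fraction at which the chain is split is adapted to $p$ (\<open>balanced_of_superadditive\<close>).
\<close>

section \<open>Maximal functions along a finite chain of sets\<close>

text \<open>
  The power mean inequality for two numbers; its constant $2^{1/p'}$ is the price of a cut of
  $f$ into two disjoint parts.
\<close>
lemma add_le_powr_mean:
  fixes x y p :: real
  assumes "0 \<le> x" "0 \<le> y" "1 \<le> p"
  shows "x + y \<le> 2 powr (1 - 1/p) * (x powr p + y powr p) powr (1/p)"
proof -
  have half: "(z / 2) powr p \<le> z powr p / 2" if "0 \<le> z" for z :: real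
  proof -
    have "2 \<le> (2::real) powr p" using powr_mono[of 1 p 2] assms by simp
    then have "z powr p / 2 powr p \<le> z powr p / 2" by (intro divide_left_mono) auto
    with that show ?thesis by (simp add: powr_divide)
  qed
  have "((x + y) / 2) powr p \<le> (x powr p + y powr p) / 2"
  proof (cases "x = 0 \<or> y = 0")
    case True
    with half[of x] half[of y] assms show ?thesis by auto
  next
    case False
    then have "((1/2) *\<^sub>R x + (1/2) *\<^sub>R y) powr p \<le> (1/2) * x powr p + (1/2) * y powr p"
      using convex_onD[OF powr_convex[OF assms(3)], of "1/2" x y] assms by simp
    then show ?thesis by (simp add: field_simps)
  qed
  then have "(((x + y) / 2) powr p) powr (1/p) \<le> ((x powr p + y powr p) / 2) powr (1/p)"
    using assms by (intro powr_mono2) auto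
  then have "(x + y) / 2 \<le> (x powr p + y powr p) powr (1/p) / 2 powr (1/p)"
    using assms by (simp add: powr_powr powr_divide)
  then show ?thesis
    by (simp add: powr_diff field_simps)
qed

text \<open>
  The recursion in the splitting argument, with all function spaces stripped off. The sizes
  \<open>\<nu> B\<close> and \<open>\<kappa> A\<close> measure the parts of $f$ on \<open>B\<close> and of $g$ on \<open>A\<close>. By
  \<open>split\<close>, a set \<open>A\<close> that carries the fraction \<open>\<theta>\<close> of \<open>A'\<close> leaves at most the
  fraction \<open>\<eta>\<close>. If \<open>K\<close> bounds the maximal function of the members of a chain below the
  splitting set and also that of the increments above it, then \<open>balance\<close> says that the same
  \<open>K\<close> bounds the whole chain; the summand $1$ in $1 + K\eta$ pays for the single operator
  value at the splitting set.
\<close>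
locale balanced_set_functions =
  fixes M :: "'a measure" and N :: "'b measure"
    and \<nu> :: "'a set \<Rightarrow> real" and \<kappa> :: "'b set \<Rightarrow> real" and \<theta> \<eta> K :: real
  assumes \<nu>_nonneg: "\<And>B. B \<in> sets M \<Longrightarrow> 0 \<le> \<nu> B"
    and \<kappa>_nonneg: "\<And>A. A \<in> sets N \<Longrightarrow> 0 \<le> \<kappa> A"
    and \<kappa>_empty: "\<kappa> {} = 0"
    and \<kappa>_mono: "\<And>A A'. A \<in> sets N \<Longrightarrow> A' \<in> sets N \<Longrightarrow> A \<subseteq> A' \<Longrightarrow> \<kappa> A \<le> \<kappa> A'"
    and split: "\<And>A A'. A \<in> sets N \<Longrightarrow> A' \<in> sets N \<Longrightarrow> A \<subseteq> A' \<Longrightarrow>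
          \<theta> * \<kappa> A' \<le> \<kappa> A \<Longrightarrow> \<kappa> (A' - A) \<le> \<eta> * \<kappa> A'"
    and balance: "\<And>B B'. B \<in> sets M \<Longrightarrow> B' \<in> sets M \<Longrightarrow> B \<inter> B' = {} \<Longrightarrow>
          K * \<theta> * \<nu> B + (1 + K * \<eta>) * \<nu> B' \<le> K * \<nu> (B \<union> B')"
    and params_nonneg: "0 \<le> \<theta>" "0 \<le> \<eta>" "0 \<le> K"
begin

text \<open>
  The splitting set is the first member of the chain that carries the fraction \<open>\<theta>\<close> of the top
  \<open>G\<close>. If there is none, then \<open>\<kappa> G < \<theta> * \<kappa> G\<close> and \<open>G\<close> itself will do, because
  nothing is left above it.
\<close>
lemma splitting_set:
  assumes fin: "finite \<A>" and ne: "\<A> \<noteq> {}" and sets: "\<A> \<subseteq> sets N"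
    and chain: "\<And>A A'. A \<in> \<A> \<Longrightarrow> A' \<in> \<A> \<Longrightarrow> A \<subseteq> A' \<or> A' \<subseteq> A"
  obtains G A\<^sub>0 where "G \<in> \<A>" "A\<^sub>0 \<in> \<A>" "\<And>A. A \<in> \<A> \<Longrightarrow> A \<subseteq> G"
    "\<And>A. A \<in> \<A> \<Longrightarrow> A \<subset> A\<^sub>0 \<Longrightarrow> \<kappa> A \<le> \<theta> * \<kappa> G" "\<kappa> (G - A\<^sub>0) \<le> \<eta> * \<kappa> G"
proof -
  obtain G where G: "G \<in> \<A>" "\<And>A. A \<in> \<A> \<Longrightarrow> G \<subseteq> A \<Longrightarrow> G = A"
    using finite_has_maximal[OF fin ne] by metis
  have top: "A \<subseteq> G" if "A \<in> \<A>" for A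
    using chain[OF that G(1)] G(2)[OF that] by auto
  define \<B> where "\<B> = {A \<in> \<A>. \<theta> * \<kappa> G \<le> \<kappa> A}"
  show thesis
  proof (cases "\<B> = {}")
    case True
    then have low: "\<kappa> A < \<theta> * \<kappa> G" if "A \<in> \<A>" for A
      using that by (force simp: \<B>_def)
    have "0 \<le> \<eta> * \<kappa> G" using G sets params_nonneg \<kappa>_nonneg by auto
    then show ?thesis using low \<kappa>_empty
      by (intro that[OF G(1) G(1) top]) (auto simp: less_imp_le)
  next
    case False
    have "finite \<B>" using fin by (simp add: \<B>_def)
    then obtain A\<^sub>0 where A0: "A\<^sub>0 \<in> \<B>" "\<And>A. A \<in> \<B> \<Longrightarrow> A \<subseteq> A\<^sub>0 \<Longrightarrow> A\<^sub>0 = A"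
      using finite_has_minimal[OF _ False] by metis
    then have "A\<^sub>0 \<in> \<A>" and le: "\<theta> * \<kappa> G \<le> \<kappa> A\<^sub>0" by (auto simp: \<B>_def)
    moreover have "\<kappa> (G - A\<^sub>0) \<le> \<eta> * \<kappa> G"
      using le \<open>A\<^sub>0 \<in> \<A>\<close> G(1) top sets by (intro split) auto
    moreover have "\<kappa> A \<le> \<theta> * \<kappa> G" if "A \<in> \<A>" "A \<subset> A\<^sub>0" for A
      using A0(2)[of A] that by (force simp: \<B>_def)
    ultimately show ?thesis using G(1) top that by blast
  qed
qed

text \<open>
  Think of \<open>h A\<close> as $|f|\,|T'(g\chi_A)|$. For the splitting set $A_0$, the members of the
  chain below $A_0$ contribute a maximal function $M_1$, and those above it at most
  $h(A_0) + M_2$, where $M_2$ is the maximal function of the increments $A \setminus A_0$. The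
  region \<open>B\<close> is cut according to which of the two is larger. Both $M_1$ and $M_2$ belong to
  shorter chains, so that no a priori finiteness of the best constant is needed.
\<close>
theorem chain_maximal_bound:
  fixes h :: "'b set \<Rightarrow> 'a \<Rightarrow> ennreal"
  assumes h_meas: "\<And>A. A \<in> sets N \<Longrightarrow> h A \<in> borel_measurable M"
    and h_sub: "\<And>A A'. A \<in> sets N \<Longrightarrow> A' \<in> sets N \<Longrightarrow> A \<subseteq> A' \<Longrightarrow>
          AE x in M. h A' x \<le> h A x + h (A' - A) x"
    and h_bound: "\<And>B A. B \<in> sets M \<Longrightarrow> A \<in> sets N \<Longrightarrow>
          (\<integral>\<^sup>+x. h A x * indicator B x \<partial>M) \<le> ennreal (\<nu> B * \<kappa> A)"
    and "finite \<A>" "\<A> \<subseteq> sets N"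
    and "\<And>A A'. A \<in> \<A> \<Longrightarrow> A' \<in> \<A> \<Longrightarrow> A \<subseteq> A' \<or> A' \<subseteq> A"
    and "B \<in> sets M" "\<And>A. A \<in> \<A> \<Longrightarrow> \<kappa> A \<le> c" "0 \<le> c"
  shows "(\<integral>\<^sup>+x. (SUP A\<in>\<A>. h A x) * indicator B x \<partial>M) \<le> ennreal (K * \<nu> B * c)"
  using assms(4-9)
proof (induction "card \<A>" arbitrary: \<A> B c rule: less_induct)
  case less
  note fin = \<open>finite \<A>\<close> and sets = \<open>\<A> \<subseteq> sets N\<close> and chain = less.prems(3) and B = \<open>B \<in> sets M\<close>
  show ?case
  proof (cases "\<A> = {}")
    case True
    then show ?thesis by (simp add: bot_ennreal)
  next
    case False
    obtain G A\<^sub>0 where G: "G \<in> \<A>" and A0: "A\<^sub>0 \<in> \<A>" and top: "\<And>A. A \<in> \<A> \<Longrightarrow> A \<subseteq> G"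
      and low: "\<And>A. A \<in> \<A> \<Longrightarrow> A \<subset> A\<^sub>0 \<Longrightarrow> \<kappa> A \<le> \<theta> * \<kappa> G" and high: "\<kappa> (G - A\<^sub>0) \<le> \<eta> * \<kappa> G"
      using splitting_set[OF fin False sets chain] by blast
    define \<A>\<^sub>1 where "\<A>\<^sub>1 = {A \<in> \<A>. A \<subset> A\<^sub>0}"
    define \<A>\<^sub>2 where "\<A>\<^sub>2 = (\<lambda>A. A - A\<^sub>0) ` {A \<in> \<A>. A\<^sub>0 \<subset> A}"
    define M\<^sub>1 where "M\<^sub>1 x = (SUP A\<in>\<A>\<^sub>1. h A x)" for x
    define M\<^sub>2 where "M\<^sub>2 x = (SUP A\<in>\<A>\<^sub>2. h A x)" for x
    have fin12: "finite \<A>\<^sub>1" "finite \<A>\<^sub>2" using fin by (auto simp: \<A>\<^sub>1_def \<A>\<^sub>2_def)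
    have sets12: "\<A>\<^sub>1 \<subseteq> sets N" "\<A>\<^sub>2 \<subseteq> sets N"
      using sets A0 by (auto simp: \<A>\<^sub>1_def \<A>\<^sub>2_def)
    have card1: "card \<A>\<^sub>1 < card \<A>"
      using fin A0 by (intro psubset_card_mono) (auto simp: \<A>\<^sub>1_def)
    have "card \<A>\<^sub>2 \<le> card {A \<in> \<A>. A\<^sub>0 \<subset> A}"
      using fin by (auto simp: \<A>\<^sub>2_def intro!: card_image_le)
    also have "\<dots> < card \<A>"
      using fin A0 by (intro psubset_card_mono) auto
    finally have card2: "card \<A>\<^sub>2 < card \<A>" .
    have [measurable]: "h A\<^sub>0 \<in> borel_measurable M" using h_meas A0 sets by auto
    have [measurable]: "M\<^sub>1 \<in> borel_measurable M" "M\<^sub>2 \<in> borel_measurable M"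
      unfolding M\<^sub>1_def M\<^sub>2_def using fin12 sets12 h_meas
      by (auto intro!: borel_measurable_SUP countable_finite)
    note [measurable] = B
    \<comment> \<open>the region where the sets below \<open>A\<^sub>0\<close> dominate\<close>
    define B\<^sub>1 where "B\<^sub>1 = {x \<in> space M. h A\<^sub>0 x + M\<^sub>2 x \<le> M\<^sub>1 x} \<inter> B"
    define B\<^sub>2 where "B\<^sub>2 = B - B\<^sub>1"
    have B12[measurable]: "B\<^sub>1 \<in> sets M" "B\<^sub>2 \<in> sets M" unfolding B\<^sub>2_def B\<^sub>1_def by measurable
    have Bun: "B\<^sub>1 \<union> B\<^sub>2 = B" "B\<^sub>1 \<inter> B\<^sub>2 = {}" by (auto simp: B\<^sub>1_def B\<^sub>2_def)
    have \<kappa>G: "0 \<le> \<kappa> G" using \<kappa>_nonneg G sets by auto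
    have n12: "0 \<le> \<nu> B\<^sub>1" "0 \<le> \<nu> B\<^sub>2" using \<nu>_nonneg B12 by auto
    have I1: "(\<integral>\<^sup>+x. M\<^sub>1 x * indicator B\<^sub>1 x \<partial>M) \<le> ennreal (K * \<nu> B\<^sub>1 * (\<theta> * \<kappa> G))"
      unfolding M\<^sub>1_def
    proof (rule less.hyps[OF card1 fin12(1) sets12(1) _ B12(1)])
      show "\<And>A A'. A \<in> \<A>\<^sub>1 \<Longrightarrow> A' \<in> \<A>\<^sub>1 \<Longrightarrow> A \<subseteq> A' \<or> A' \<subseteq> A"
        using chain by (auto simp: \<A>\<^sub>1_def)
    qed (use low \<kappa>G params_nonneg in \<open>auto simp: \<A>\<^sub>1_def\<close>)
    have I2: "(\<integral>\<^sup>+x. M\<^sub>2 x * indicator B\<^sub>2 x \<partial>M) \<le> ennreal (K * \<nu> B\<^sub>2 * (\<eta> * \<kappa> G))"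
      unfolding M\<^sub>2_def
    proof (rule less.hyps[OF card2 fin12(2) sets12(2) _ B12(2)])
      show "A \<subseteq> A' \<or> A' \<subseteq> A" if "A \<in> \<A>\<^sub>2" "A' \<in> \<A>\<^sub>2" for A A'
        using that chain unfolding \<A>\<^sub>2_def by blast
      show "\<kappa> A \<le> \<eta> * \<kappa> G" if "A \<in> \<A>\<^sub>2" for A
      proof -
        have "\<kappa> A \<le> \<kappa> (G - A\<^sub>0)"
          using that top sets12 sets G A0 by (intro \<kappa>_mono) (auto simp: \<A>\<^sub>2_def)
        with high show ?thesis by simp
      qed
    qed (use \<kappa>G params_nonneg in auto)
    have "\<kappa> A\<^sub>0 \<le> \<kappa> G" using A0 G sets top by (intro \<kappa>_mono) auto
    then have I0: "(\<integral>\<^sup>+x. h A\<^sub>0 x * indicator B\<^sub>2 x \<partial>M) \<le> ennreal (\<nu> B\<^sub>2 * \<kappa> G)"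
      using h_bound[OF B12(2), of A\<^sub>0] A0 sets n12
      by (meson ennreal_leI mult_left_mono order_trans subsetD)
    have ae: "AE x in M. \<forall>A\<in>{A \<in> \<A>. A\<^sub>0 \<subset> A}. h A x \<le> h A\<^sub>0 x + h (A - A\<^sub>0) x"
      using fin A0 sets by (intro AE_finite_allI) (auto intro!: h_sub)
    have "(\<integral>\<^sup>+x. (SUP A\<in>\<A>. h A x) * indicator B x \<partial>M) \<le>
      (\<integral>\<^sup>+x. M\<^sub>1 x * indicator B\<^sub>1 x + (h A\<^sub>0 x * indicator B\<^sub>2 x + M\<^sub>2 x * indicator B\<^sub>2 x) \<partial>M)"
    proof (rule nn_integral_mono_AE, use ae AE_space in eventually_elim)
      case (elim x)
      have "h A x \<le> max (M\<^sub>1 x) (h A\<^sub>0 x + M\<^sub>2 x)" if A: "A \<in> \<A>" for A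
      proof -
        consider "A \<subset> A\<^sub>0" | "A = A\<^sub>0" | "A\<^sub>0 \<subset> A" using chain[OF A A0] by blast
        then show ?thesis
        proof cases
          case 1
          then have "h A x \<le> M\<^sub>1 x" unfolding M\<^sub>1_def using A by (intro SUP_upper) (auto simp: \<A>\<^sub>1_def)
          then show ?thesis by (simp add: le_max_iff_disj)
        next
          case 2
          then show ?thesis by (simp add: le_max_iff_disj)
        next
          case 3
          then have "h (A - A\<^sub>0) x \<le> M\<^sub>2 x"
            unfolding M\<^sub>2_def using A by (intro SUP_upper) (auto simp: \<A>\<^sub>2_def)
          moreover have "h A x \<le> h A\<^sub>0 x + h (A - A\<^sub>0) x" using elim 3 A by auto
          ultimately have "h A x \<le> h A\<^sub>0 x + M\<^sub>2 x" by (meson add_left_mono order_trans)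
          then show ?thesis by (simp add: le_max_iff_disj)
        qed
      qed
      then have "(SUP A\<in>\<A>. h A x) \<le> max (M\<^sub>1 x) (h A\<^sub>0 x + M\<^sub>2 x)" by (intro SUP_least)
      with \<open>x \<in> space M\<close> show ?case
        by (auto simp: B\<^sub>1_def B\<^sub>2_def max_def indicator_def split: if_splits)
    qed
    also have "\<dots> = (\<integral>\<^sup>+x. M\<^sub>1 x * indicator B\<^sub>1 x \<partial>M) +
        ((\<integral>\<^sup>+x. h A\<^sub>0 x * indicator B\<^sub>2 x \<partial>M) + (\<integral>\<^sup>+x. M\<^sub>2 x * indicator B\<^sub>2 x \<partial>M))"
      by (subst nn_integral_add; (subst nn_integral_add)?) auto
    also have "\<dots> \<le> ennreal (K * \<nu> B\<^sub>1 * (\<theta> * \<kappa> G)) +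
        (ennreal (\<nu> B\<^sub>2 * \<kappa> G) + ennreal (K * \<nu> B\<^sub>2 * (\<eta> * \<kappa> G)))"
      by (intro add_mono I0 I1 I2)
    also have "\<dots> = ennreal ((K * \<theta> * \<nu> B\<^sub>1 + (1 + K * \<eta>) * \<nu> B\<^sub>2) * \<kappa> G)"
      using n12 \<kappa>G params_nonneg by (simp flip: ennreal_plus add: algebra_simps)
    also have "\<dots> \<le> ennreal (K * \<nu> B * c)"
    proof (intro ennreal_leI mult_mono)
      show "K * \<theta> * \<nu> B\<^sub>1 + (1 + K * \<eta>) * \<nu> B\<^sub>2 \<le> K * \<nu> B"
        using balance[OF B12 Bun(2)] Bun(1) by simp
    qed (use less.prems G \<kappa>G \<nu>_nonneg[OF B] params_nonneg in auto)
    finally show ?thesis .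
  qed
qed

end

section \<open>Restrictions and the dual norm\<close>

definition restr :: "('a \<Rightarrow> 'k::real_normed_field) \<Rightarrow> 'a set \<Rightarrow> 'a \<Rightarrow> 'k" where
  "restr f B = (\<lambda>x. f x * indicator B x)"

lemma norm_restr: "norm (restr f B x) = norm (f x) * indicator B x"
  by (simp add: restr_def indicator_def)

lemma restr_restr: "restr (restr f A) B = restr f (A \<inter> B)"
  by (auto simp: restr_def indicator_def)

lemma restr_measurable [measurable]:
  fixes f :: "'a \<Rightarrow> 'k::{real_normed_field, second_countable_topology}"
  assumes "f \<in> borel_measurable M" "B \<in> sets M"
  shows "restr f B \<in> borel_measurable M"
  using assms unfolding restr_def by simp

text \<open>
  The constants of the theory are infima of admissible constants, and are themselves admissible.
  Finiteness of the infimum excludes the empty set of constants, for which the right hand side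
  would be $\infty \cdot 0 = 0$ when \<open>b\<close> vanishes.
\<close>
lemma le_Inf_mult_ennreal:
  fixes a b :: ennreal
  assumes "\<And>C. C \<in> S \<Longrightarrow> a \<le> C * b" and "Inf S < \<infinity>" and "b < \<infinity>"
  shows "a \<le> Inf S * b"
proof (cases "b = 0")
  case True
  have "S \<noteq> {}" using assms(2) by auto
  with assms(1) True show ?thesis by auto
next
  case False
  have "a / b \<le> Inf S"
    using assms(1,3) False by (intro Inf_greatest divide_le_posI_ennreal) (auto simp: mult.commute zero_less_iff_neq_zero)
  then have "a / b * b \<le> Inf S * b" by (rule mult_right_mono) simp
  then show ?thesis using False assms(3)
    by (simp add: ennreal_divide_times ennreal_times_divide mult_divide_eq_ennreal)
qed

lemma upper_const_n_bound:
  assumes "\<And>j. j < n \<Longrightarrow> x j \<in> elems X" "disjointly_supported (base X) n x"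
    and "upper_const_n q n X \<le> ennreal u" "0 \<le> u" "0 \<le> lp_sum q n (\<lambda>j. nrm X (x j))"
  shows "nrm X (\<lambda>t. \<Sum>j<n. x j t) \<le> u * lp_sum q n (\<lambda>j. nrm X (x j))"
proof -
  have "ennreal (nrm X (\<lambda>t. \<Sum>j<n. x j t)) \<le> upper_const_n q n X * ennreal (lp_sum q n (\<lambda>j. nrm X (x j)))"
    unfolding upper_const_n_def
  proof (rule le_Inf_mult_ennreal)
    show "Inf {C :: ennreal. \<forall>x. (\<forall>j<n. x j \<in> elems X) \<and> disjointly_supported (base X) n x \<longrightarrow>
       ennreal (nrm X (\<lambda>t. \<Sum>j<n. x j t)) \<le> C * ennreal (lp_sum q n (\<lambda>j. nrm X (x j)))} < \<infinity>"
      using assms(3) unfolding upper_const_n_def by (simp add: le_less_trans)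
  qed (use assms(1,2) in auto)
  also have "\<dots> \<le> ennreal u * ennreal (lp_sum q n (\<lambda>j. nrm X (x j)))"
    by (intro mult_right_mono assms) simp
  finally show ?thesis using assms(4,5) by (simp flip: ennreal_mult')
qed

lemma lower_const_n_bound:
  assumes "\<And>j. j < n \<Longrightarrow> x j \<in> elems X" "disjointly_supported (base X) n x"
    and "lower_const_n p n X \<le> ennreal l" "0 \<le> l" "0 \<le> nrm X (\<lambda>t. \<Sum>j<n. x j t)"
  shows "lp_sum p n (\<lambda>j. nrm X (x j)) \<le> l * nrm X (\<lambda>t. \<Sum>j<n. x j t)"
proof -
  have "ennreal (lp_sum p n (\<lambda>j. nrm X (x j))) \<le> lower_const_n p n X * ennreal (nrm X (\<lambda>t. \<Sum>j<n. x j t))"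
    unfolding lower_const_n_def
  proof (rule le_Inf_mult_ennreal)
    show "Inf {C :: ennreal. \<forall>x. (\<forall>j<n. x j \<in> elems X) \<and> disjointly_supported (base X) n x \<longrightarrow>
       ennreal (lp_sum p n (\<lambda>j. nrm X (x j))) \<le> C * ennreal (nrm X (\<lambda>t. \<Sum>j<n. x j t))} < \<infinity>"
      using assms(3) unfolding lower_const_n_def by (simp add: le_less_trans)
  qed (use assms(1,2) in auto)
  also have "\<dots> \<le> ennreal l * ennreal (nrm X (\<lambda>t. \<Sum>j<n. x j t))"
    by (intro mult_right_mono assms) simp
  finally show ?thesis using assms(4,5) by (simp flip: ennreal_mult')
qed

lemma norm_sum_disjoint:
  fixes x :: "nat \<Rightarrow> 'k::real_normed_vector"
  assumes "\<And>i j. i < n \<Longrightarrow> j < n \<Longrightarrow> i \<noteq> j \<Longrightarrow> x i = 0 \<or> x j = 0"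
  shows "norm (\<Sum>j<n. x j) = (\<Sum>j<n. norm (x j))"
proof (cases "\<exists>i<n. x i \<noteq> 0")
  case True
  then obtain i where i: "i < n" "x i \<noteq> 0" by blast
  then have z: "x j = 0" if "j < n" "j \<noteq> i" for j using assms[of i j] that by auto
  have "(\<Sum>j<n. x j) = (\<Sum>j\<in>{i}. x j)" "(\<Sum>j<n. norm (x j)) = (\<Sum>j\<in>{i}. norm (x j))"
    using i z by (intro sum.mono_neutral_right; auto)+
  then show ?thesis by simp
qed auto

lemma disjointly_supportedI:
  assumes "\<And>i j. i < n \<Longrightarrow> j < n \<Longrightarrow> i \<noteq> j \<Longrightarrow> G i \<inter> G j = {}"
    and "\<And>i t. i < n \<Longrightarrow> t \<notin> G i \<Longrightarrow> x i t = 0"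
  shows "disjointly_supported M n x"
  unfolding disjointly_supported_def using assms by (intro allI impI AE_I2) blast

text \<open>
  Real valued, so that real powers of the dual norm can be taken.
\<close>
definition koethe_nrm ::
  "('a, 'k::{real_normed_field, banach, second_countable_topology}) function_space \<Rightarrow>
   ('a \<Rightarrow> 'k) \<Rightarrow> real" where
  "koethe_nrm E g = enn2real (koethe_norm E g)"

context banach_function_lattice
begin

lemma restr_mem: "f \<in> elems E \<Longrightarrow> B \<in> sets (base E) \<Longrightarrow> restr f B \<in> elems E"
  and nrm_restr_le: "f \<in> elems E \<Longrightarrow> B \<in> sets (base E) \<Longrightarrow> nrm E (restr f B) \<le> nrm E f"
  using elems_measurable
  by (auto intro!: ideal_mem[of f] nrm_mono[of f] restr_measurable simp: norm_restr indicator_def)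

lemma nrm_restr_mono:
  assumes "f \<in> elems E" "A \<in> sets (base E)" "B \<in> sets (base E)" "A \<subseteq> B"
  shows "nrm E (restr f A) \<le> nrm E (restr f B)"
  using nrm_restr_le[OF restr_mem[OF assms(1,3)] assms(2)] assms(4)
  by (simp add: restr_restr Int_absorb1)

lemma sum_mem:
  "(\<And>j. j < (n::nat) \<Longrightarrow> x j \<in> elems E) \<Longrightarrow> (\<lambda>t. \<Sum>j<n. x j t) \<in> elems E"
  by (induction n) (auto simp: zero_mem add_mem)

text \<open>
  The definition of the dual norm, rescaled. Functions of norm $0$ cannot be rescaled, but they
  vanish almost everywhere.
\<close>
lemma koethe_hoelder:
  assumes f: "f \<in> elems E" and h[measurable]: "h \<in> borel_measurable (base E)"
  shows "(\<integral>\<^sup>+x. ennreal (norm (f x)) * h x \<partial>base E) \<le> ennreal (nrm E f) * koethe_norm_ext E h"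
proof (cases "nrm E f = 0")
  case True
  then have "AE x in base E. f x = 0" using nrm_eq_0_iff[OF f] by simp
  then have "(\<integral>\<^sup>+x. ennreal (norm (f x)) * h x \<partial>base E) = (\<integral>\<^sup>+x. 0 \<partial>base E)"
    by (intro nn_integral_cong_AE) auto
  then show ?thesis by simp
next
  case False
  define c where "c = nrm E f"
  have c: "c > 0" using False nrm_nonneg[OF f] by (simp add: c_def)
  have [measurable]: "f \<in> borel_measurable (base E)" using f elems_measurable by auto
  let ?f = "\<lambda>x. of_real (1 / c) * f x"
  have "nrm E ?f \<le> 1" using c nrm_scale[OF f, of "of_real (1/c)"] by (simp add: c_def norm_divide)
  then have le: "(\<integral>\<^sup>+x. ennreal (norm (?f x)) * h x \<partial>base E) \<le> koethe_norm_ext E h"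
    unfolding koethe_norm_ext_def using scale_mem[OF f] by (intro SUP_upper) blast
  have "(\<integral>\<^sup>+x. ennreal (norm (f x)) * h x \<partial>base E)
      = (\<integral>\<^sup>+x. ennreal c * (ennreal (norm (?f x)) * h x) \<partial>base E)"
    using c by (intro nn_integral_cong) (simp add: norm_mult norm_divide flip: mult.assoc ennreal_mult')
  also have "\<dots> = ennreal c * (\<integral>\<^sup>+x. ennreal (norm (?f x)) * h x \<partial>base E)"
    by (intro nn_integral_cmult) auto
  also have "\<dots> \<le> ennreal c * koethe_norm_ext E h" by (intro mult_left_mono le) simp
  finally show ?thesis by (simp add: c_def)
qed

lemma koethe_norm_ext_mono_AE:
  assumes "AE x in base E. h x \<le> h' x"
  shows "koethe_norm_ext E h \<le> koethe_norm_ext E h'"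
  unfolding koethe_norm_ext_def
  by (intro SUP_mono', intro nn_integral_mono_AE, use assms in eventually_elim)
     (auto intro: mult_left_mono)

lemma koethe_dual_measurable: "g \<in> koethe_dual E \<Longrightarrow> g \<in> borel_measurable (base E)"
  by (simp add: koethe_dual_def)

lemma koethe_norm_restr_le: "koethe_norm E (restr g A) \<le> koethe_norm E g"
  unfolding koethe_norm_def by (intro koethe_norm_ext_mono_AE) (auto simp: norm_restr indicator_def)

lemma koethe_dual_restr:
  "g \<in> koethe_dual E \<Longrightarrow> A \<in> sets (base E) \<Longrightarrow> restr g A \<in> koethe_dual E"
  using koethe_norm_restr_le[of g A] by (auto simp: koethe_dual_def intro: le_less_trans)

lemma ennreal_koethe_nrm: "g \<in> koethe_dual E \<Longrightarrow> ennreal (koethe_nrm E g) = koethe_norm E g"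
  by (simp add: koethe_nrm_def koethe_dual_def)

lemma koethe_nrm_nonneg: "0 \<le> koethe_nrm E g" by (simp add: koethe_nrm_def)

lemma koethe_nrm_restr_mono:
  assumes "g \<in> koethe_dual E" "A \<in> sets (base E)" "B \<in> sets (base E)" "A \<subseteq> B"
  shows "koethe_nrm E (restr g A) \<le> koethe_nrm E (restr g B)"
  using koethe_norm_restr_le[of "restr g B" A] assms koethe_dual_restr[OF assms(1,3)]
  unfolding koethe_nrm_def by (intro enn2real_mono) (auto simp: restr_restr Int_absorb1 koethe_dual_def)

lemma koethe_nrm_restr_le:
  assumes "g \<in> koethe_dual E"
  shows "koethe_nrm E (restr g A) \<le> koethe_nrm E g"
  using koethe_norm_restr_le[of g A] assms
  unfolding koethe_nrm_def by (intro enn2real_mono) (auto simp: koethe_dual_def)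

lemma koethe_nrm_restr_empty: "koethe_nrm E (restr g {}) = 0"
  by (simp add: koethe_nrm_def koethe_norm_def koethe_norm_ext_def restr_def SUP_constant bot_ennreal)

text \<open>
  The pieces of \<open>f\<close> on disjoint sets are disjointly supported and add up to a restriction of
  \<open>f\<close>, whose norm is at most that of \<open>f\<close>.
\<close>
lemma lower_estimate_restr:
  assumes p: "1 \<le> p" and l: "lower_const_n (ennreal p) n E \<le> ennreal l" "0 \<le> l"
    and f: "f \<in> elems E" and B: "\<And>j. j < n \<Longrightarrow> B j \<in> sets (base E)"
    and disj: "\<And>i j. i < n \<Longrightarrow> j < n \<Longrightarrow> i \<noteq> j \<Longrightarrow> B i \<inter> B j = {}"
  shows "(\<Sum>j<n. nrm E (restr f (B j)) powr p) \<le> (l * nrm E f) powr p"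
proof -
  let ?S = "\<Sum>j<n. nrm E (restr f (B j)) powr p" and ?x = "\<lambda>j. restr f (B j)"
  have [measurable]: "f \<in> borel_measurable (base E)" using f elems_measurable by auto
  have mem: "?x j \<in> elems E" if "j < n" for j using that f B restr_mem by blast
  have sumrestr: "norm (\<Sum>j<n. ?x j t) \<le> norm (f t)" for t
  proof -
    have "(\<Sum>j<n. indicator (B j) t :: real) = indicator (\<Union>j<n. B j) t"
      using disj by (subst indicator_UN_disjoint) (auto simp: disjoint_family_on_def)
    moreover have "norm (\<Sum>j<n. ?x j t) \<le> (\<Sum>j<n. norm (f t) * indicator (B j) t)"
      by (intro sum_norm_le) (simp add: norm_restr)
    ultimately have "norm (\<Sum>j<n. ?x j t) \<le> norm (f t) * indicator (\<Union>j<n. B j) t"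
      by (simp flip: sum_distrib_left)
    also have "\<dots> \<le> norm (f t)" by (simp add: indicator_def)
    finally show ?thesis .
  qed
  have "lp_sum (ennreal p) n (\<lambda>j. nrm E (?x j)) \<le> l * nrm E (\<lambda>t. \<Sum>j<n. ?x j t)"
  proof (rule lower_const_n_bound[OF mem _ l])
    show "disjointly_supported (base E) n ?x"
      by (rule disjointly_supportedI[where G=B]) (auto simp: disj restr_def)
    show "0 \<le> nrm E (\<lambda>t. \<Sum>j<n. ?x j t)" by (intro nrm_nonneg sum_mem mem)
  qed
  also have "\<dots> \<le> l * nrm E f"
    using sumrestr l(2) B f
    by (intro mult_left_mono nrm_mono) (auto intro!: borel_measurable_sum)
  finally have "?S powr (1/p) \<le> l * nrm E f" using p by (simp add: lp_sum_def)
  then have "(?S powr (1/p)) powr p \<le> (l * nrm E f) powr p" using p by (intro powr_mono2) auto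
  then show ?thesis using p by (simp add: powr_powr sum_nonneg)
qed

end

section \<open>Lower estimates for the dual\<close>

text \<open>
  The conjugate exponent of $q > 1$ is a real number even for $q = \infty$. The last clause
  separates this case, in which the power sum of \<open>lp_sum\<close> is a maximum.
\<close>
lemma conj_exponent_gt_1:
  assumes "1 < q"
  obtains r where "1 \<le> r" "conj_exponent q = ennreal r" "enn2real (1 / q) = 1 - 1 / r"
    "q = \<infinity> \<and> r = 1 \<or> (\<exists>Q>1. q = ennreal Q \<and> 1 / Q = 1 - 1 / r \<and> (r - 1) * Q = r)"
proof (cases q)
  case (real Q)
  have Q: "1 < Q" using assms real by simp
  have one: "1 / q = ennreal (1 / Q)" using Q real by (simp add: divide_ennreal flip: ennreal_1)
  have "1 - 1 / q = ennreal (1 - 1 / Q)" unfolding one using Q by (simp add: ennreal_minus flip: ennreal_1)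
  then have "conj_exponent q = ennreal (1 / (1 - 1 / Q))"
    using Q by (simp add: conj_exponent_def divide_ennreal flip: ennreal_1)
  then show ?thesis using Q one real
    by (intro that[of "1 / (1 - 1 / Q)"]) (auto simp: field_simps)
next
  case top
  then show ?thesis by (intro that[of 1]) (auto simp: conj_exponent_def)
qed

lemma conj_exponent_ratio:
  assumes "1 \<le> P" "p = ennreal P"
  shows "enn2real (1 / conj_exponent p) = 1 - 1 / P"
    "0 \<le> r \<Longrightarrow> enn2real (ennreal r / conj_exponent p) = r * (1 - 1 / P)"
    "enn2real (1 / p) = 1 / P"
proof -
  have one: "1 / p = ennreal (1 / P)" using assms by (simp add: divide_ennreal flip: ennreal_1)
  show "enn2real (1 / p) = 1 / P" using assms(1) by (simp add: one)
  have d: "1 - 1 / p = ennreal (1 - 1 / P)" unfolding one using assms by (simp add: ennreal_minus flip: ennreal_1)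
  have *: "ennreal r / conj_exponent p = ennreal (r * (1 - 1 / P))" if "0 \<le> r" for r
  proof (cases "P = 1")
    case True
    then show ?thesis using d by (simp add: conj_exponent_def ennreal_divide_top)
  next
    case False
    then have "conj_exponent p = ennreal (1 / (1 - 1 / P))"
      using assms unfolding conj_exponent_def d by (simp add: divide_ennreal flip: ennreal_1)
    then show ?thesis using False assms that
      by (simp add: divide_ennreal del: divide_divide_eq_left)
  qed
  from *[of 1] show "enn2real (1 / conj_exponent p) = 1 - 1 / P" using assms(1) by simp
  from * show "0 \<le> r \<Longrightarrow> enn2real (ennreal r / conj_exponent p) = r * (1 - 1 / P)"
    using assms(1) by simp
qed

context banach_function_lattice
begin

lemma koethe_nrm_almost_attained:
  assumes g: "g \<in> koethe_dual E" and d: "d < 1"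
  obtains f where "f \<in> elems E" "nrm E f \<le> 1"
    "ennreal (d * koethe_nrm E g) \<le> (\<integral>\<^sup>+x. ennreal (norm (f x)) * ennreal (norm (g x)) \<partial>base E)"
proof (cases "koethe_nrm E g = 0")
  case True
  then show ?thesis using that[OF zero_mem] nrm_eq_0_iff[OF zero_mem] by simp
next
  case False
  then have "ennreal (d * koethe_nrm E g) < ennreal (koethe_nrm E g)"
    using d koethe_nrm_nonneg[of g] by (intro ennreal_lessI) (auto simp: less_le)
  then have "ennreal (d * koethe_nrm E g) < koethe_norm E g" using ennreal_koethe_nrm[OF g] by simp
  then show ?thesis
    unfolding koethe_norm_def koethe_norm_ext_def less_SUP_iff using that by (auto intro: less_imp_le)
qed

text \<open>
  An upper $q$-estimate for a lattice gives a lower $q'$-estimate for its dual with the same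
  constant. For each $j$ there is $f_j$ in the unit ball that almost norms $g\chi_{G_j}$.
  Testing $g$ against $\sum_j c_j f_j \chi_{G_j}$ gives
  $\sum_j c_j \|g\chi_{G_j}\| \le u\,\|(c_j)\|_{\ell^q}\,\|g\|$ up to a factor close to
  $1$, and $c_j = \|g\chi_{G_j}\|^{r-1}$ with $r = q'$ is the case of equality in Hoelder's
  inequality.
\<close>
lemma koethe_dual_lower_estimate_restr:
  assumes q: "1 < q" and r: "1 \<le> r" "conj_exponent q = ennreal r"
    and u: "upper_const_n q n E \<le> ennreal u" "0 \<le> u"
    and g: "g \<in> koethe_dual E" and G: "\<And>j. j < n \<Longrightarrow> G j \<in> sets (base E)"
    and disj: "\<And>i j. i < n \<Longrightarrow> j < n \<Longrightarrow> i \<noteq> j \<Longrightarrow> G i \<inter> G j = {}"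
  shows "(\<Sum>j<n. koethe_nrm E (restr g (G j)) powr r) \<le> (u * koethe_nrm E g) powr r"
proof -
  define \<kappa> where "\<kappa> j = koethe_nrm E (restr g (G j))" for j
  define S where "S = (\<Sum>j<n. \<kappa> j powr r)"
  have \<kappa>0: "0 \<le> \<kappa> j" for j by (simp add: \<kappa>_def koethe_nrm_nonneg)
  have [measurable]: "g \<in> borel_measurable (base E)" using g by (rule koethe_dual_measurable)
  have gmem: "restr g (G j) \<in> koethe_dual E" if "j < n" for j using that g G koethe_dual_restr by blast
  show ?thesis
  proof (cases "S = 0")
    case True
    then show ?thesis by (simp add: S_def \<kappa>_def)
  next
    case False
    then have S: "S > 0" by (simp add: S_def sum_nonneg less_le)
    then have n: "n > 0" by (auto simp: S_def intro: gr0I)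
    have cases_q: "q = \<infinity> \<and> r = 1 \<or> (\<exists>Q>1. q = ennreal Q \<and> 1 / Q = 1 - 1 / r \<and> (r - 1) * Q = r)"
      using conj_exponent_gt_1[OF q] r by (metis ennreal_inj order.trans zero_le_one)
    \<comment> \<open>the factor \<open>d < 1\<close> accounts for suprema that are not attained\<close>
    have "d * S \<le> u * S powr (1 - 1/r) * koethe_nrm E g" if d: "0 < d" "d < 1" for d
    proof -
      define c where "c j = \<kappa> j powr (r - 1)" for j
      have c\<kappa>: "c j * \<kappa> j = \<kappa> j powr r" for j
        using \<kappa>0[of j] powr_add[of "\<kappa> j" "r - 1" 1] by (cases "\<kappa> j = 0") (auto simp: c_def)
      have "\<forall>j. \<exists>f. j < n \<longrightarrow> f \<in> elems E \<and> nrm E f \<le> 1 \<and>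
          ennreal (d * \<kappa> j) \<le> (\<integral>\<^sup>+x. ennreal (norm (f x)) * ennreal (norm (restr g (G j) x)) \<partial>base E)"
        using koethe_nrm_almost_attained[OF gmem d(2)] unfolding \<kappa>_def by metis
      then obtain f where f: "\<And>j. j < n \<Longrightarrow> f j \<in> elems E" "\<And>j. j < n \<Longrightarrow> nrm E (f j) \<le> 1"
          "\<And>j. j < n \<Longrightarrow> ennreal (d * \<kappa> j) \<le>
              (\<integral>\<^sup>+x. ennreal (norm (f j x)) * ennreal (norm (restr g (G j) x)) \<partial>base E)"
        by metis
      define x where "x j = restr (\<lambda>t. of_real (c j) * f j t) (G j)" for j
      have [measurable]: "f j \<in> borel_measurable (base E)" if "j < n" for j
        using f(1)[OF that] elems_measurable by auto
      have c0: "0 \<le> c j" for j by (simp add: c_def)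
      have mem: "x j \<in> elems E" if "j < n" for j
        unfolding x_def using that f G by (intro restr_mem scale_mem)
      have nrmx: "nrm E (x j) \<le> c j" if "j < n" for j
      proof -
        have "nrm E (x j) \<le> nrm E (\<lambda>t. of_real (c j) * f j t)"
          unfolding x_def using that f G by (intro nrm_restr_le scale_mem)
        also have "\<dots> = c j * nrm E (f j)" using nrm_scale[OF f(1)[OF that]] c0 by simp
        also have "\<dots> \<le> c j" using f(2)[OF that] c0 by (simp add: mult_left_le)
        finally show ?thesis .
      qed
      have nrmx0: "0 \<le> nrm E (x j)" if "j < n" for j using nrm_nonneg mem that by blast
      have lp: "0 \<le> lp_sum q n (\<lambda>j. nrm E (x j)) \<and> lp_sum q n (\<lambda>j. nrm E (x j)) \<le> S powr (1 - 1/r)"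
        using cases_q
      proof
        assume *: "q = \<infinity> \<and> r = 1"
        have "nrm E (x j) \<le> 1" if "j < n" for j
          using nrmx[OF that] * by (cases "\<kappa> j = 0") (auto simp: c_def)
        moreover have "0 \<le> nrm E (x 0)" using nrmx0 n by auto
        moreover have "finite ((\<lambda>j. nrm E (x j)) ` {..<n})" "(\<lambda>j. nrm E (x j)) ` {..<n} \<noteq> {}"
          using n by auto
        ultimately have "0 \<le> (MAX j\<in>{..<n}. nrm E (x j))" "(MAX j\<in>{..<n}. nrm E (x j)) \<le> 1"
          using n by (auto simp: Max_ge_iff)
        then show ?thesis using * S by (auto simp: lp_sum_def)
      next
        assume "\<exists>Q>1. q = ennreal Q \<and> 1 / Q = 1 - 1 / r \<and> (r - 1) * Q = r"
        then obtain Q where Q: "Q > 1" "q = ennreal Q" "1 / Q = 1 - 1 / r" "(r - 1) * Q = r" by blast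
        have "(\<Sum>j<n. nrm E (x j) powr Q) \<le> (\<Sum>j<n. c j powr Q)"
          using nrmx nrmx0 Q by (intro sum_mono powr_mono2) auto
        also have "\<dots> = S" using Q by (simp add: c_def powr_powr S_def)
        finally have "(\<Sum>j<n. nrm E (x j) powr Q) powr (1/Q) \<le> S powr (1/Q)"
          using Q r by (intro powr_mono2) (auto intro!: sum_nonneg)
        then show ?thesis using Q r by (simp add: lp_sum_def)
      qed
      have disjx: "x i t = 0 \<or> x j t = 0" if "i < n" "j < n" "i \<noteq> j" for i j t
        using disj[OF that] by (auto simp: x_def restr_def indicator_def)
      have "d * S = (\<Sum>j<n. c j * (d * \<kappa> j))"
        by (simp add: S_def sum_distrib_left mult.left_commute flip: c\<kappa>)
      then have "ennreal (d * S) = (\<Sum>j<n. ennreal (c j) * ennreal (d * \<kappa> j))"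
        using c0 \<kappa>0 d by (simp flip: ennreal_mult add: sum_nonneg sum_ennreal)
      also have "\<dots> \<le> (\<Sum>j<n. ennreal (c j) *
            (\<integral>\<^sup>+t. ennreal (norm (f j t)) * ennreal (norm (restr g (G j) t)) \<partial>base E))"
        using f(3) by (intro sum_mono mult_left_mono) auto
      also have "\<dots> = (\<Sum>j<n. \<integral>\<^sup>+t. ennreal (norm (x j t)) * ennreal (norm (g t)) \<partial>base E)"
      proof (rule sum.cong[OF refl])
        fix j assume "j \<in> {..<n}"
        then have j: "j < n" by simp
        note [measurable] = G[OF j]
        have "ennreal (c j) * (\<integral>\<^sup>+t. ennreal (norm (f j t)) * ennreal (norm (restr g (G j) t)) \<partial>base E)
          = (\<integral>\<^sup>+t. ennreal (c j) * (ennreal (norm (f j t)) * ennreal (norm (restr g (G j) t))) \<partial>base E)"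
          using j by (intro nn_integral_cmult[symmetric]) measurable
        also have "\<dots> = (\<integral>\<^sup>+t. ennreal (norm (x j t)) * ennreal (norm (g t)) \<partial>base E)"
          using c0[of j] by (intro nn_integral_cong)
            (simp add: x_def norm_restr norm_mult indicator_def ennreal_mult mult.assoc)
        finally show "ennreal (c j) * (\<integral>\<^sup>+t. ennreal (norm (f j t)) * ennreal (norm (restr g (G j) t)) \<partial>base E)
          = (\<integral>\<^sup>+t. ennreal (norm (x j t)) * ennreal (norm (g t)) \<partial>base E)" .
      qed
      also have "\<dots> = (\<integral>\<^sup>+t. (\<Sum>j<n. ennreal (norm (x j t)) * ennreal (norm (g t))) \<partial>base E)"
      proof (rule nn_integral_sum[symmetric])
        fix j assume "j \<in> {..<n}"
        then have [measurable]: "x j \<in> borel_measurable (base E)" using mem elems_measurable by auto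
        show "(\<lambda>t. ennreal (norm (x j t)) * ennreal (norm (g t))) \<in> borel_measurable (base E)"
          by measurable
      qed
      also have "\<dots> = (\<integral>\<^sup>+t. ennreal (norm (\<Sum>j<n. x j t)) * ennreal (norm (g t)) \<partial>base E)"
      proof (rule nn_integral_cong)
        fix t
        have "norm (\<Sum>j<n. x j t) = (\<Sum>j<n. norm (x j t))" using disjx by (intro norm_sum_disjoint)
        then show "(\<Sum>j<n. ennreal (norm (x j t)) * ennreal (norm (g t)))
            = ennreal (norm (\<Sum>j<n. x j t)) * ennreal (norm (g t))"
          by (simp flip: sum_distrib_right add: sum_ennreal)
      qed
      also have "\<dots> \<le> ennreal (nrm E (\<lambda>t. \<Sum>j<n. x j t)) * koethe_norm E g"
        unfolding koethe_norm_def by (intro koethe_hoelder sum_mem mem) auto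
      also have "\<dots> \<le> ennreal (u * S powr (1 - 1/r)) * koethe_norm E g"
      proof (intro mult_right_mono ennreal_leI)
        have "nrm E (\<lambda>t. \<Sum>j<n. x j t) \<le> u * lp_sum q n (\<lambda>j. nrm E (x j))"
        proof (rule upper_const_n_bound[OF mem _ u])
          show "disjointly_supported (base E) n x"
            by (rule disjointly_supportedI[where G=G]) (auto simp: disj x_def restr_def)
        qed (use lp in auto)
        also have "\<dots> \<le> u * S powr (1 - 1/r)" using lp u by (intro mult_left_mono) auto
        finally show "nrm E (\<lambda>t. \<Sum>j<n. x j t) \<le> u * S powr (1 - 1/r)" .
      qed simp
      also have "\<dots> = ennreal (u * S powr (1 - 1/r) * koethe_nrm E g)"
        using u by (simp add: ennreal_mult'' koethe_nrm_nonneg flip: ennreal_koethe_nrm[OF g])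
      finally show ?thesis using u koethe_nrm_nonneg by simp
    qed
    then have "S \<le> u * S powr (1 - 1/r) * koethe_nrm E g" by (rule field_le_mult_one_interval)
    moreover have "S = S powr (1 - 1/r) * S powr (1/r)" using S by (simp flip: powr_add)
    ultimately have "S powr (1 - 1/r) * S powr (1/r) \<le> S powr (1 - 1/r) * (u * koethe_nrm E g)"
      by (simp add: mult_ac)
    then have "S powr (1/r) \<le> u * koethe_nrm E g" using S by simp
    then have "(S powr (1/r)) powr r \<le> (u * koethe_nrm E g) powr r" using r by (intro powr_mono2) auto
    then show ?thesis using S r by (simp add: powr_powr S_def \<kappa>_def)
  qed
qed

end

section \<open>Superadditive envelopes and balanced set functions\<close>

text \<open>
  The pieces form a set of sets instead of a sequence, so that the pieces of two disjoint sets
  can simply be united. Since the empty set is excluded, this union of families is disjoint.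
\<close>
definition disjoint_pieces :: "'a measure \<Rightarrow> 'a set \<Rightarrow> 'a set set set" where
  "disjoint_pieces M B = {P. finite P \<and> P \<subseteq> sets M \<and> disjoint P \<and> {} \<notin> P \<and> \<Union>P \<subseteq> B}"

text \<open>
  For $\varphi(B) = \|f\chi_B\|^p$ in a lattice with a lower $p$-estimate, the $p$-th root of the
  envelope is an equivalent norm of $f\chi_B$ whose lower $p$-estimate has constant $1$.
\<close>
definition superadditive_envelope :: "'a measure \<Rightarrow> ('a set \<Rightarrow> real) \<Rightarrow> 'a set \<Rightarrow> real" where
  "superadditive_envelope M \<phi> B = (SUP P\<in>disjoint_pieces M B. \<Sum>A\<in>P. \<phi> A)"

lemma empty_in_disjoint_pieces: "{} \<in> disjoint_pieces M B"
  by (simp add: disjoint_pieces_def)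

locale bounded_on_pieces =
  fixes M :: "'a measure" and \<phi> :: "'a set \<Rightarrow> real" and C :: real
  assumes bound: "\<And>P B. P \<in> disjoint_pieces M B \<Longrightarrow> (\<Sum>A\<in>P. \<phi> A) \<le> C"
    and empty: "\<phi> {} = 0"
begin

lemma bdd: "bdd_above ((\<lambda>P. \<Sum>A\<in>P. \<phi> A) ` disjoint_pieces M B)"
  by (rule bdd_aboveI[of _ C]) (auto intro: bound)

lemma pieces_le_envelope:
  "P \<in> disjoint_pieces M B \<Longrightarrow> (\<Sum>A\<in>P. \<phi> A) \<le> superadditive_envelope M \<phi> B"
  unfolding superadditive_envelope_def by (intro cSUP_upper bdd)

lemma envelope_le:
  "(\<And>P. P \<in> disjoint_pieces M B \<Longrightarrow> (\<Sum>A\<in>P. \<phi> A) \<le> c) \<Longrightarrow> superadditive_envelope M \<phi> B \<le> c"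
  unfolding superadditive_envelope_def using empty_in_disjoint_pieces by (intro cSUP_least) auto

lemma envelope_nonneg: "0 \<le> superadditive_envelope M \<phi> B"
  using pieces_le_envelope[OF empty_in_disjoint_pieces] by simp

lemma envelope_bound: "superadditive_envelope M \<phi> B \<le> C"
  by (intro envelope_le bound)

lemma envelope_ge: "B \<in> sets M \<Longrightarrow> \<phi> B \<le> superadditive_envelope M \<phi> B"
  using pieces_le_envelope[of "{B}" B] envelope_nonneg[of B] empty
  by (cases "B = {}") (auto simp: disjoint_pieces_def)

lemma envelope_empty: "superadditive_envelope M \<phi> {} = 0"
  by (intro antisym envelope_nonneg envelope_le)
     (auto simp: disjoint_pieces_def intro!: sum_nonpos)

lemma envelope_superadditive:
  assumes "B \<inter> B' = {}"
  shows "superadditive_envelope M \<phi> B + superadditive_envelope M \<phi> B'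
    \<le> superadditive_envelope M \<phi> (B \<union> B')"
proof -
  have *: "(\<Sum>A\<in>P. \<phi> A) + (\<Sum>A\<in>P'. \<phi> A) \<le> superadditive_envelope M \<phi> (B \<union> B')"
    if P: "P \<in> disjoint_pieces M B" and P': "P' \<in> disjoint_pieces M B'" for P P'
  proof -
    have "P \<inter> P' = {}"
    proof (rule equals0I)
      fix A assume "A \<in> P \<inter> P'"
      then have "A \<subseteq> B \<inter> B'" "A \<noteq> {}" using P P' by (auto simp: disjoint_pieces_def)
      then show False using assms by simp
    qed
    then have "(\<Sum>A\<in>P. \<phi> A) + (\<Sum>A\<in>P'. \<phi> A) = (\<Sum>A\<in>P \<union> P'. \<phi> A)"
      using P P' by (intro sum.union_disjoint[symmetric]) (auto simp: disjoint_pieces_def)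
    also have "P \<union> P' \<in> disjoint_pieces M (B \<union> B')"
    proof -
      have "\<Union>P \<subseteq> B" "\<Union>P' \<subseteq> B'" using P P' by (auto simp: disjoint_pieces_def)
      then have "\<Union>P \<inter> \<Union>P' = {}" using assms by blast
      then have "disjoint (P \<union> P')" using P P' by (intro disjoint_union) (auto simp: disjoint_pieces_def)
      then show ?thesis using P P' by (auto simp: disjoint_pieces_def)
    qed
    then have "(\<Sum>A\<in>P \<union> P'. \<phi> A) \<le> superadditive_envelope M \<phi> (B \<union> B')"
      by (rule pieces_le_envelope)
    finally show ?thesis .
  qed
  have "superadditive_envelope M \<phi> B' \<le> superadditive_envelope M \<phi> (B \<union> B') - (\<Sum>A\<in>P. \<phi> A)"
    if "P \<in> disjoint_pieces M B" for P
    using *[OF that] by (intro envelope_le) (simp add: le_diff_eq add.commute)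
  then have "superadditive_envelope M \<phi> B \<le> superadditive_envelope M \<phi> (B \<union> B') - superadditive_envelope M \<phi> B'"
    by (intro envelope_le) (simp add: le_diff_eq add.commute)
  then show ?thesis by simp
qed

end

lemma disjoint_pieces_enumerate:
  assumes "P \<in> disjoint_pieces M B"
  obtains G where "bij_betw G {..<card P} P"
    "\<And>j. j < card P \<Longrightarrow> G j \<in> sets M"
    "\<And>i j. i < card P \<Longrightarrow> j < card P \<Longrightarrow> i \<noteq> j \<Longrightarrow> G i \<inter> G j = {}"
proof -
  have fin: "finite P" and P: "P \<subseteq> sets M" "disjoint P" using assms by (auto simp: disjoint_pieces_def)
  obtain G where G: "bij_betw G {..<card P} P"
    using ex_bij_betw_nat_finite[OF fin] by (auto simp: atLeast0LessThan)
  then have mem: "G j \<in> P" if "j < card P" for j using that by (auto simp: bij_betw_def)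
  moreover have "G i \<inter> G j = {}" if "i < card P" "j < card P" "i \<noteq> j" for i j
  proof -
    have "G i \<noteq> G j" using that G by (auto simp: bij_betw_def inj_on_def)
    then show ?thesis using disjointD[OF P(2)] mem that by blast
  qed
  ultimately show ?thesis using that[OF G] P(1) by blast
qed

context banach_function_lattice
begin

lemma bounded_on_pieces_nrm:
  assumes p: "1 \<le> p" and l: "lower_const (ennreal p) E \<le> ennreal l" "0 \<le> l" and f: "f \<in> elems E"
  shows "bounded_on_pieces (base E) (\<lambda>B. nrm E (restr f B) powr p) ((l * nrm E f) powr p)"
proof
  have "restr f {} = (\<lambda>x. 0)" by (auto simp: restr_def)
  then show "nrm E (restr f {}) powr p = 0" using nrm_eq_0_iff[OF zero_mem] by simp
  fix P B assume P: "P \<in> disjoint_pieces (base E) B"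
  then obtain G where G: "bij_betw G {..<card P} P"
    "\<And>j. j < card P \<Longrightarrow> G j \<in> sets (base E)"
    "\<And>i j. i < card P \<Longrightarrow> j < card P \<Longrightarrow> i \<noteq> j \<Longrightarrow> G i \<inter> G j = {}"
    by (rule disjoint_pieces_enumerate) blast
  show "(\<Sum>A\<in>P. nrm E (restr f A) powr p) \<le> (l * nrm E f) powr p"
  proof (cases "P = {}")
    case False
    then have "card P \<ge> 1" using P by (simp add: disjoint_pieces_def Suc_leI card_gt_0_iff)
    then have "lower_const_n (ennreal p) (card P) E \<le> lower_const (ennreal p) E"
      unfolding lower_const_def by (intro SUP_upper) auto
    then have "lower_const_n (ennreal p) (card P) E \<le> ennreal l" using l by simp
    then show ?thesis
      using lower_estimate_restr[OF p _ l(2) f G(2,3)]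
      by (subst sum.reindex_bij_betw[OF G(1), symmetric]) auto
  qed simp
qed

lemma bounded_on_pieces_koethe_nrm:
  assumes q: "1 < q" and r: "1 \<le> r" "conj_exponent q = ennreal r"
    and u: "upper_const q E \<le> ennreal u" "0 \<le> u" and g: "g \<in> koethe_dual E"
  shows "bounded_on_pieces (base E) (\<lambda>A. koethe_nrm E (restr g A) powr r) ((u * koethe_nrm E g) powr r)"
proof
  show "koethe_nrm E (restr g {}) powr r = 0" by (simp add: koethe_nrm_restr_empty)
  fix P B assume P: "P \<in> disjoint_pieces (base E) B"
  then obtain G where G: "bij_betw G {..<card P} P"
    "\<And>j. j < card P \<Longrightarrow> G j \<in> sets (base E)"
    "\<And>i j. i < card P \<Longrightarrow> j < card P \<Longrightarrow> i \<noteq> j \<Longrightarrow> G i \<inter> G j = {}"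
    by (rule disjoint_pieces_enumerate) blast
  show "(\<Sum>A\<in>P. koethe_nrm E (restr g A) powr r) \<le> (u * koethe_nrm E g) powr r"
  proof (cases "P = {}")
    case False
    then have "card P \<ge> 1" using P by (simp add: disjoint_pieces_def Suc_leI card_gt_0_iff)
    then have "upper_const_n q (card P) E \<le> upper_const q E"
      unfolding upper_const_def by (intro SUP_upper) auto
    then have "upper_const_n q (card P) E \<le> ennreal u" using u by simp
    then show ?thesis
      using koethe_dual_lower_estimate_restr[OF q r _ u(2) g G(2,3)]
      by (subst sum.reindex_bij_betw[OF G(1), symmetric]) auto
  qed simp
qed

end

text \<open>
  The constant in the case of full estimates. A set that carries the fraction $1/a$, where
  $a = 2^{1/p'}$, of the $r$-th root of a superadditive function leaves at most the fraction
  $(1 - a^{-r})^{1/r} = c/a$. The number $K = a/(1-c)$ solves $1 + Kc/a = K/a$, so that both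
  parts of \<open>B\<close> enter the balance with the same weight $K/a$; the factor $a$ lost in the
  power mean inequality turns this weight into $K$. The condition $1/p' < 1/r$ means
  $a^r < 2$, hence $c < 1$. The factor \<open>D\<close> makes room for an operator norm.
\<close>
lemma balanced_of_superadditive:
  fixes \<nu> :: "'a set \<Rightarrow> real" and \<kappa> :: "'b set \<Rightarrow> real" and D :: real
  assumes pr: "1 \<le> p" "1 \<le> r" "1 - 1/p < 1/r" and D: "0 \<le> D"
    and \<nu>: "\<And>B. B \<in> sets M \<Longrightarrow> 0 \<le> \<nu> B"
      "\<And>B B'. B \<in> sets M \<Longrightarrow> B' \<in> sets M \<Longrightarrow> B \<inter> B' = {} \<Longrightarrow> \<nu> B + \<nu> B' \<le> \<nu> (B \<union> B')"
    and \<kappa>: "\<And>A. A \<in> sets N \<Longrightarrow> 0 \<le> \<kappa> A" "\<kappa> {} = 0"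
      "\<And>A A'. A \<in> sets N \<Longrightarrow> A' \<in> sets N \<Longrightarrow> A \<inter> A' = {} \<Longrightarrow> \<kappa> A + \<kappa> A' \<le> \<kappa> (A \<union> A')"
  defines "a \<equiv> 2 powr (1 - 1/p)" and "c \<equiv> (2 powr (r * (1 - 1/p)) - 1) powr (1/r)"
  shows "balanced_set_functions M N (\<lambda>B. D * \<nu> B powr (1/p)) (\<lambda>A. \<kappa> A powr (1/r)) (1/a) (c/a) (a / (1 - c))"
    and "0 \<le> a / (1 - c)"
proof -
  have a: "1 \<le> a" unfolding a_def using pr by (intro ge_one_powr_ge_zero) auto
  have ar: "a powr r = 2 powr (r * (1 - 1/p))" by (simp add: a_def powr_powr mult.commute)
  have ar1: "1 \<le> a powr r" using a pr by (intro ge_one_powr_ge_zero) auto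
  have "r * (1 - 1/p) < 1" using pr by (simp add: field_simps)
  then have "2 powr (r * (1 - 1/p)) < (2::real) powr 1" by (intro powr_less_mono) auto
  then have ar2: "a powr r < 2" using ar by simp
  have c_eq: "c = (a powr r - 1) powr (1/r)" by (simp add: c_def ar)
  have "(a powr r - 1) powr (1/r) < 1 powr (1/r)" using ar1 ar2 pr by (intro powr_less_mono2) auto
  then have c: "0 \<le> c" "c < 1" by (auto simp: c_eq)
  show K: "0 \<le> a / (1 - c)" using a c by simp
  show "balanced_set_functions M N (\<lambda>B. D * \<nu> B powr (1/p)) (\<lambda>A. \<kappa> A powr (1/r)) (1/a) (c/a) (a / (1 - c))"
  proof
    fix A A' assume A: "A \<in> sets N" "A' \<in> sets N" "A \<subseteq> A'"
    have "\<kappa> A + \<kappa> (A' - A) \<le> \<kappa> (A \<union> (A' - A))" using A by (intro \<kappa>(3)) auto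
    moreover have "A \<union> (A' - A) = A'" using A by auto
    ultimately have add: "\<kappa> A + \<kappa> (A' - A) \<le> \<kappa> A'" by simp
    have pos: "0 \<le> \<kappa> A" "0 \<le> \<kappa> A'" "0 \<le> \<kappa> (A' - A)" using A \<kappa>(1) by auto
    from add pos have "\<kappa> A \<le> \<kappa> A'" by linarith
    then show "\<kappa> A powr (1/r) \<le> \<kappa> A' powr (1/r)" using pos pr by (intro powr_mono2) auto
    assume "1/a * \<kappa> A' powr (1/r) \<le> \<kappa> A powr (1/r)"
    then have "(1/a * \<kappa> A' powr (1/r)) powr r \<le> (\<kappa> A powr (1/r)) powr r"
      using pr a by (intro powr_mono2) auto
    then have "\<kappa> A' / a powr r \<le> \<kappa> A"
      using pr a pos by (simp add: powr_mult powr_divide powr_powr)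
    with add have "\<kappa> (A' - A) \<le> \<kappa> A' - \<kappa> A' / a powr r" by linarith
    also have "\<dots> = (a powr r - 1) / a powr r * \<kappa> A'"
      using ar1 a by (simp add: diff_divide_distrib left_diff_distrib)
    finally have "\<kappa> (A' - A) \<le> (a powr r - 1) / a powr r * \<kappa> A'" .
    then have "\<kappa> (A' - A) powr (1/r) \<le> ((a powr r - 1) / a powr r * \<kappa> A') powr (1/r)"
      using pos pr by (intro powr_mono2) auto
    also have "\<dots> = c / a * \<kappa> A' powr (1/r)"
      using pos pr ar1 a by (simp add: powr_mult powr_divide powr_powr c_eq)
    finally show "\<kappa> (A' - A) powr (1/r) \<le> c / a * \<kappa> A' powr (1/r)" .
  next
    fix B B' assume B: "B \<in> sets M" "B' \<in> sets M" "B \<inter> B' = {}"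
    have pos: "0 \<le> \<nu> B" "0 \<le> \<nu> B'" using B \<nu> by auto
    have "\<nu> B powr (1/p) + \<nu> B' powr (1/p) \<le> a * ((\<nu> B powr (1/p)) powr p + (\<nu> B' powr (1/p)) powr p) powr (1/p)"
      unfolding a_def using pr by (intro add_le_powr_mean) auto
    also have "\<dots> = a * (\<nu> B + \<nu> B') powr (1/p)" using pr pos by (simp add: powr_powr)
    also have "\<dots> \<le> a * \<nu> (B \<union> B') powr (1/p)"
      using pr pos a \<nu>(2)[OF B] by (intro mult_left_mono powr_mono2) auto
    finally have *: "\<nu> B powr (1/p) + \<nu> B' powr (1/p) \<le> a * \<nu> (B \<union> B') powr (1/p)" .
    have eqs: "1 + a / (1 - c) * (c / a) = 1 / (1 - c)" "a / (1 - c) * (1/a) = 1 / (1 - c)"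
      using a c by (auto simp: field_simps)
    have "a / (1 - c) * (1/a) * (D * \<nu> B powr (1/p)) + (1 + a / (1 - c) * (c / a)) * (D * \<nu> B' powr (1/p))
        = D / (1 - c) * (\<nu> B powr (1/p) + \<nu> B' powr (1/p))"
      by (simp only: eqs) (simp add: ring_distribs add_divide_distrib)
    also have "\<dots> \<le> D / (1 - c) * (a * \<nu> (B \<union> B') powr (1/p))"
      using D c by (intro mult_left_mono *) auto
    finally show "a / (1 - c) * (1/a) * (D * \<nu> B powr (1/p)) + (1 + a / (1 - c) * (c / a)) * (D * \<nu> B' powr (1/p))
        \<le> a / (1 - c) * (D * \<nu> (B \<union> B') powr (1/p))"
      by (simp add: mult_ac)
  qed (use D a c K \<kappa>(2) pr in auto)
qed

text \<open>
  With two-piece estimates only, the chain is split evenly: on either side of the splitting set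
  remains at most the fraction $\theta = 2^{-1/r}u$. Cutting \<open>B\<close> costs another
  $2^{1-1/p}\,l$, so that the recursion multiplies $K$ by $b = l u\,2^{1-1/p-1/r}$, and
  $1 + bK = K$ for $K = 1/(1-b)$.
\<close>
lemma balanced_of_two_piece_estimates:
  fixes \<nu> :: "'a set \<Rightarrow> real" and \<kappa> :: "'b set \<Rightarrow> real" and D l u :: real
  assumes pr: "1 \<le> p" "1 \<le> r" and D: "0 \<le> D" and lu: "0 \<le> l" "0 \<le> u"
    and \<nu>: "\<And>B. B \<in> sets M \<Longrightarrow> 0 \<le> \<nu> B"
      "\<And>B B'. B \<in> sets M \<Longrightarrow> B' \<in> sets M \<Longrightarrow> B \<subseteq> B' \<Longrightarrow> \<nu> B \<le> \<nu> B'"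
      "\<And>B B'. B \<in> sets M \<Longrightarrow> B' \<in> sets M \<Longrightarrow> B \<inter> B' = {} \<Longrightarrow>
        \<nu> B powr p + \<nu> B' powr p \<le> (l * \<nu> (B \<union> B')) powr p"
    and \<kappa>: "\<And>A. A \<in> sets N \<Longrightarrow> 0 \<le> \<kappa> A" "\<kappa> {} = 0"
      "\<And>A A'. A \<in> sets N \<Longrightarrow> A' \<in> sets N \<Longrightarrow> A \<subseteq> A' \<Longrightarrow> \<kappa> A \<le> \<kappa> A'"
      "\<And>A A'. A \<in> sets N \<Longrightarrow> A' \<in> sets N \<Longrightarrow> A \<inter> A' = {} \<Longrightarrow>
        \<kappa> A powr r + \<kappa> A' powr r \<le> (u * \<kappa> (A \<union> A')) powr r"
  defines "\<theta> \<equiv> u / 2 powr (1/r)" and "b \<equiv> l * u * 2 powr (1 - 1/p - 1/r)"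
  assumes b: "b < 1"
  shows "balanced_set_functions M N (\<lambda>B. D * \<nu> B) \<kappa> \<theta> \<theta> (1 / (1 - b))"
proof -
  have \<theta>: "0 \<le> \<theta>" using lu by (simp add: \<theta>_def)
  show ?thesis
  proof
    fix A A' assume A: "A \<in> sets N" "A' \<in> sets N" "A \<subseteq> A'"
    have un: "A \<union> (A' - A) = A'" using A by auto
    then have add: "\<kappa> A powr r + \<kappa> (A' - A) powr r \<le> (u * \<kappa> A') powr r"
      using \<kappa>(4)[of A "A' - A"] A by auto
    have pos: "0 \<le> \<kappa> A" "0 \<le> \<kappa> A'" "0 \<le> \<kappa> (A' - A)" using A \<kappa>(1) by auto
    have half: "(\<theta> * \<kappa> A') powr r = (u * \<kappa> A') powr r / 2"
      using pr lu pos by (simp add: \<theta>_def powr_mult powr_divide powr_powr)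
    assume "\<theta> * \<kappa> A' \<le> \<kappa> A"
    then have "(\<theta> * \<kappa> A') powr r \<le> \<kappa> A powr r" using pr pos \<theta> by (intro powr_mono2) auto
    with add half have "\<kappa> (A' - A) powr r \<le> (\<theta> * \<kappa> A') powr r" by linarith
    then have "(\<kappa> (A' - A) powr r) powr (1/r) \<le> ((\<theta> * \<kappa> A') powr r) powr (1/r)"
      by (rule powr_mono2[rotated 2]) (use pr in auto)
    then show "\<kappa> (A' - A) \<le> \<theta> * \<kappa> A'" using pr pos \<theta> by (simp add: powr_powr)
  next
    fix B B' assume B: "B \<in> sets M" "B' \<in> sets M" "B \<inter> B' = {}"
    have pos: "0 \<le> \<nu> B" "0 \<le> \<nu> B'" "0 \<le> \<nu> (B \<union> B')" using B \<nu> by auto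
    have "\<nu> B + \<nu> B' \<le> 2 powr (1 - 1/p) * (\<nu> B powr p + \<nu> B' powr p) powr (1/p)"
      using pr pos by (intro add_le_powr_mean) auto
    also have "\<dots> \<le> 2 powr (1 - 1/p) * ((l * \<nu> (B \<union> B')) powr p) powr (1/p)"
      using pr \<nu>(3)[OF B] by (intro mult_left_mono powr_mono2) auto
    also have "\<dots> = 2 powr (1 - 1/p) * l * \<nu> (B \<union> B')" using pr pos lu by (simp add: powr_powr)
    finally have "\<theta> * (\<nu> B + \<nu> B') \<le> \<theta> * (2 powr (1 - 1/p) * l * \<nu> (B \<union> B'))"
      using lu by (intro mult_left_mono) (auto simp: \<theta>_def)
    also have "\<dots> = b * \<nu> (B \<union> B')" by (simp add: \<theta>_def b_def powr_diff mult_ac)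
    finally have 1: "\<theta> * (\<nu> B + \<nu> B') \<le> b * \<nu> (B \<union> B')" .
    have 2: "\<nu> B' \<le> \<nu> (B \<union> B')" using B by (intro \<nu>) auto
    define w where "w = 1 / (1 - b)"
    have w: "w * (1 - b) = 1" "0 \<le> w" using b by (auto simp: w_def)
    have "w * \<theta> * (D * \<nu> B) + (1 + w * \<theta>) * (D * \<nu> B')
        = w * \<theta> * (D * \<nu> B) + (w * (1 - b) + w * \<theta>) * (D * \<nu> B')"
      by (simp only: w(1))
    also have "\<dots> = w * D * (\<theta> * (\<nu> B + \<nu> B') + (1 - b) * \<nu> B')"
      by algebra
    also have "\<dots> \<le> w * D * (b * \<nu> (B \<union> B') + (1 - b) * \<nu> (B \<union> B'))"
      using b D 1 2 w by (intro mult_left_mono add_mono) auto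
    also have "\<dots> = w * (D * \<nu> (B \<union> B'))" by algebra
    finally show "1 / (1 - b) * \<theta> * (D * \<nu> B) + (1 + 1 / (1 - b) * \<theta>) * (D * \<nu> B')
        \<le> 1 / (1 - b) * (D * \<nu> (B \<union> B'))"
      by (simp only: w_def)
  qed (use D \<nu>(1) \<kappa>(1,2,3) \<theta> b in auto)
qed

section \<open>From finite chains to the maximal operator\<close>

lemma filtration_chain:
  assumes "filtration N Q r A" "S \<subseteq> Q" "\<alpha> \<in> S" "\<beta> \<in> S"
  shows "A \<alpha> \<subseteq> A \<beta> \<or> A \<beta> \<subseteq> A \<alpha>"
proof (cases "\<alpha> = \<beta>")
  case False
  then have "(\<alpha>, \<beta>) \<in> r \<or> (\<beta>, \<alpha>) \<in> r"
    using assms unfolding filtration_def linear_order_on_def total_on_def by blast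
  then show ?thesis using assms(1) False by (metis filtration_def)
qed simp

text \<open>
  A set of natural numbers is exhausted by the finite sets \<open>Q \<inter> {..n}\<close>.
\<close>
lemma nn_integral_SUP_finite_subsets:
  fixes h :: "nat \<Rightarrow> 'a \<Rightarrow> ennreal"
  assumes meas: "\<And>\<alpha>. \<alpha> \<in> Q \<Longrightarrow> h \<alpha> \<in> borel_measurable M"
    and le: "\<And>S. finite S \<Longrightarrow> S \<subseteq> Q \<Longrightarrow> (\<integral>\<^sup>+x. (SUP \<alpha>\<in>S. h \<alpha> x) \<partial>M) \<le> C"
  shows "(\<integral>\<^sup>+x. (SUP \<alpha>\<in>Q. h \<alpha> x) \<partial>M) \<le> C"
proof -
  have eq: "(SUP \<alpha>\<in>Q. h \<alpha> x) = (SUP n. SUP \<alpha>\<in>Q \<inter> {..n}. h \<alpha> x)" for x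
  proof (intro antisym SUP_least)
    fix \<alpha> assume "\<alpha> \<in> Q"
    then have "h \<alpha> x \<le> (SUP \<alpha>\<in>Q \<inter> {..\<alpha>}. h \<alpha> x)" by (intro SUP_upper) auto
    also have "\<dots> \<le> (SUP n. SUP \<alpha>\<in>Q \<inter> {..n}. h \<alpha> x)" by (intro SUP_upper) auto
    finally show "h \<alpha> x \<le> (SUP n. SUP \<alpha>\<in>Q \<inter> {..n}. h \<alpha> x)" .
  qed (auto intro: SUP_upper)
  have "(\<integral>\<^sup>+x. (SUP \<alpha>\<in>Q. h \<alpha> x) \<partial>M) = (SUP n. \<integral>\<^sup>+x. (SUP \<alpha>\<in>Q \<inter> {..n}. h \<alpha> x) \<partial>M)"
    unfolding eq
  proof (rule nn_integral_monotone_convergence_SUP)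
    show "incseq (\<lambda>n x. SUP \<alpha>\<in>Q \<inter> {..n}. h \<alpha> x)"
      by (intro incseq_SucI le_funI SUP_subset_mono) auto
    show "(\<lambda>x. SUP \<alpha>\<in>Q \<inter> {..n}. h \<alpha> x) \<in> borel_measurable M" for n
      by (intro borel_measurable_SUP countable_finite) (auto intro: meas)
  qed
  also have "\<dots> \<le> C" by (intro SUP_least le) auto
  finally show ?thesis .
qed

lemma koethe_op_norm_bound:
  assumes "g \<in> koethe_dual F" "koethe_op_norm F E S < \<infinity>"
  shows "koethe_norm_ext E (S g) \<le> koethe_op_norm F E S * koethe_norm F g"
  unfolding koethe_op_norm_def
  by (rule le_Inf_mult_ennreal) (use assms in \<open>auto simp: koethe_op_norm_def koethe_dual_def\<close>)

lemma koethe_op_norm_le: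
  assumes "\<And>g. g \<in> koethe_dual F \<Longrightarrow> koethe_norm_ext E (S g) \<le> K * koethe_norm F g"
  shows "koethe_op_norm F E S \<le> K"
  unfolding koethe_op_norm_def using assms by (intro Inf_lower) auto

text \<open>
  Duality and Hoelder's inequality. The integral of $|f|\,|T'g|$ is first rewritten as that of
  $f_1 T'g$, where $f_1$ has at most the modulus of $f$ and the phase that makes the product
  nonnegative.
\<close>
lemma koethe_dual_map_bounded:
  fixes E :: "('a, 'k::{real_normed_field, banach, second_countable_topology}) function_space"
    and F :: "('b, 'k) function_space"
  assumes "banach_function_lattice E" "banach_function_lattice F"
    and T: "bounded_linear_map_ae E F T" and T': "is_koethe_dual_map E F T T'"
  shows "koethe_op_norm_linear F E T' < \<infinity>"
proof -
  interpret E: banach_function_lattice E by fact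
  interpret F: banach_function_lattice F by fact
  obtain B0 where B0: "\<And>f. f \<in> elems E \<Longrightarrow> nrm F (T f) \<le> B0 * nrm E f"
    using T by (auto simp: bounded_linear_map_ae_def)
  have "koethe_op_norm_linear F E T' \<le> ennreal \<bar>B0\<bar>"
  proof (rule koethe_op_norm_le)
    fix g assume g: "g \<in> koethe_dual F"
    have T'g: "T' g \<in> koethe_dual E"
      using T' g by (auto simp: is_koethe_dual_map_def linear_map_ae_def)
    have [measurable]: "g \<in> borel_measurable (base F)" "T' g \<in> borel_measurable (base E)"
      using g T'g by (auto simp: koethe_dual_def)
    show "koethe_norm_ext E (\<lambda>x. ennreal (norm (T' g x))) \<le> ennreal \<bar>B0\<bar> * koethe_norm F g"
      unfolding koethe_norm_ext_def
    proof (rule SUP_least)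
      fix f assume "f \<in> {f \<in> elems E. nrm E f \<le> 1}"
      then have f: "f \<in> elems E" "nrm E f \<le> 1" by auto
      have [measurable]: "f \<in> borel_measurable (base E)" using f E.elems_measurable by auto
      define f1 :: "'a \<Rightarrow> 'k" where "f1 x = of_real (norm (f x) * norm (T' g x)) / T' g x" for x
      have [measurable]: "f1 \<in> borel_measurable (base E)" unfolding f1_def by measurable
      have f1_le: "norm (f1 x) \<le> norm (f x)" for x
        by (cases "T' g x = 0") (auto simp: f1_def norm_divide norm_mult)
      have f1_mult: "f1 x * T' g x = of_real (norm (f x) * norm (T' g x))" for x
        by (cases "T' g x = 0") (auto simp: f1_def)
      have f1: "f1 \<in> elems E" "nrm E f1 \<le> nrm E f"
        using f f1_le by (auto intro!: E.ideal_mem[of f] E.nrm_mono[of f])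
      have Tf1: "T f1 \<in> elems F" using T f1 by (auto simp: bounded_linear_map_ae_def linear_map_ae_def)
      have [measurable]: "T f1 \<in> borel_measurable (base F)" using Tf1 F.elems_measurable by auto
      have eq: "ennreal (norm (f x)) * ennreal (norm (T' g x)) = ennreal (norm (f x) * norm (T' g x))" for x
        by (simp add: ennreal_mult)
      have fin: "(\<integral>\<^sup>+x. ennreal (norm (f x) * norm (T' g x)) \<partial>base E) < \<infinity>"
        using E.koethe_hoelder[OF f(1), of "\<lambda>x. ennreal (norm (T' g x))"] T'g
        by (auto simp: eq koethe_dual_def koethe_norm_def ennreal_mult_less_top intro: le_less_trans)
      have int: "integrable (base E) (\<lambda>x. norm (f x) * norm (T' g x))"
        using fin by (simp add: integrable_iff_bounded)
      have "(\<integral>\<^sup>+x. ennreal (norm (f x)) * ennreal (norm (T' g x)) \<partial>base E)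
          = ennreal (\<integral>x. norm (f x) * norm (T' g x) \<partial>base E)"
        unfolding eq by (rule nn_integral_eq_integral[OF int]) simp
      also have "(\<integral>x. norm (f x) * norm (T' g x) \<partial>base E) = norm (\<integral>x. f1 x * T' g x \<partial>base E)"
        unfolding f1_mult by (subst integral_of_real[OF int]) (simp add: integral_nonneg_AE)
      also have "(\<integral>x. f1 x * T' g x \<partial>base E) = (\<integral>y. g y * T f1 y \<partial>base F)"
        using T' f1 g by (auto simp: is_koethe_dual_map_def)
      also have "ennreal (norm (\<integral>y. g y * T f1 y \<partial>base F)) \<le> (\<integral>\<^sup>+y. ennreal (norm (g y * T f1 y)) \<partial>base F)"
      proof (cases "integrable (base F) (\<lambda>y. g y * T f1 y)")
        case True
        then show ?thesis by (rule integral_norm_bound_ennreal)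
      qed (simp add: not_integrable_integral_eq)
      also have "\<dots> = (\<integral>\<^sup>+y. ennreal (norm (T f1 y)) * ennreal (norm (g y)) \<partial>base F)"
        by (intro nn_integral_cong) (simp add: norm_mult mult.commute flip: ennreal_mult)
      also have "\<dots> \<le> ennreal (nrm F (T f1)) * koethe_norm F g"
        unfolding koethe_norm_def using Tf1 by (intro F.koethe_hoelder) auto
      also have "\<dots> \<le> ennreal \<bar>B0\<bar> * koethe_norm F g"
      proof (intro mult_right_mono ennreal_leI)
        have "nrm F (T f1) \<le> B0 * nrm E f1" by (rule B0[OF f1(1)])
        also have "\<dots> \<le> \<bar>B0\<bar> * 1"
          using f1 f E.nrm_nonneg[OF f1(1)] by (intro mult_mono) auto
        finally show "nrm F (T f1) \<le> \<bar>B0\<bar>" by simp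
      qed simp
      finally show "(\<integral>\<^sup>+x. ennreal (norm (f x)) * ennreal (norm (T' g x)) \<partial>base E) \<le> ennreal \<bar>B0\<bar> * koethe_norm F g" .
    qed
  qed
  then show ?thesis by (rule le_less_trans) simp
qed

text \<open>
  The abstract chain bound, applied to $h(G) = |f|\,|T'(g\chi_G)|$. Finite subsets of the index
  set suffice by monotone convergence.
\<close>
lemma maximal_op_bound:
  fixes E :: "('a, 'k::{real_normed_field, banach, second_countable_topology}) function_space"
    and F :: "('b, 'k) function_space" and A :: "nat \<Rightarrow> 'b set"
  assumes "banach_function_lattice E" "banach_function_lattice F"
    and T': "linear_map_ae (base F) (koethe_dual F) (base E) (koethe_dual E) T'"
    and D: "0 \<le> D" "\<And>g. g \<in> koethe_dual F \<Longrightarrow> koethe_norm E (T' g) \<le> ennreal D * koethe_norm F g"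
    and filt: "filtration (base F) Q r A"
    and g: "g \<in> koethe_dual F" and f: "f \<in> elems E"
    and bal: "balanced_set_functions (base E) (base F) \<nu> \<kappa> \<theta> \<eta> K"
    and \<nu>: "\<And>B. B \<in> sets (base E) \<Longrightarrow> D * nrm E (restr f B) \<le> \<nu> B"
    and \<kappa>: "\<And>A. A \<in> sets (base F) \<Longrightarrow> koethe_nrm F (restr g A) \<le> \<kappa> A"
    and c: "\<And>A. A \<in> sets (base F) \<Longrightarrow> \<kappa> A \<le> c"
  shows "(\<integral>\<^sup>+x. ennreal (norm (f x)) * maximal_op T' Q A g x \<partial>base E) \<le> ennreal (K * \<nu> (space (base E)) * c)"
proof -
  interpret E: banach_function_lattice E by fact
  interpret F: banach_function_lattice F by fact
  interpret balanced_set_functions "base E" "base F" \<nu> \<kappa> \<theta> \<eta> K by fact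
  define h where "h G x = ennreal (norm (f x)) * ennreal (norm (T' (restr g G) x))" for G x
  have [measurable]: "f \<in> borel_measurable (base E)" using f E.elems_measurable by auto
  have restr_g: "restr g G \<in> koethe_dual F" if "G \<in> sets (base F)" for G
    using F.koethe_dual_restr g that by blast
  have T'_mem: "T' (restr g G) \<in> koethe_dual E" if "G \<in> sets (base F)" for G
    using T' restr_g[OF that] by (auto simp: linear_map_ae_def)
  have T'_meas: "T' (restr g G) \<in> borel_measurable (base E)" if "G \<in> sets (base F)" for G
    using T'_mem[OF that] by (simp add: koethe_dual_def)
  have h_meas: "h G \<in> borel_measurable (base E)" if "G \<in> sets (base F)" for G
    using T'_meas[OF that] unfolding h_def by measurable
  have c0: "0 \<le> c" using c[of "{}"] \<kappa>_empty by simp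
  have h_sub: "AE x in base E. h G' x \<le> h G x + h (G' - G) x"
    if G: "G \<in> sets (base F)" "G' \<in> sets (base F)" "G \<subseteq> G'" for G G'
  proof -
    have "(\<lambda>y. restr g G y + restr g (G' - G) y) = restr g G'"
      using G(3) by (auto simp: restr_def indicator_def fun_eq_iff)
    moreover have "AE x in base E. T' (\<lambda>y. restr g G y + restr g (G' - G) y) x
        = T' (restr g G) x + T' (restr g (G' - G)) x"
      using T' restr_g G by (auto simp: linear_map_ae_def)
    ultimately have "AE x in base E. T' (restr g G') x = T' (restr g G) x + T' (restr g (G' - G)) x"
      by simp
    then show ?thesis
    proof eventually_elim
      case (elim x)
      have "ennreal (norm (T' (restr g G') x)) \<le> ennreal (norm (T' (restr g G) x)) + ennreal (norm (T' (restr g (G' - G)) x))"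
        unfolding elim by (simp flip: ennreal_plus add: norm_triangle_ineq)
      then show ?case unfolding h_def by (simp flip: distrib_left add: mult_left_mono)
    qed
  qed
  have h_bound: "(\<integral>\<^sup>+x. h G x * indicator B x \<partial>base E) \<le> ennreal (\<nu> B * \<kappa> G)"
    if B: "B \<in> sets (base E)" and G: "G \<in> sets (base F)" for B G
  proof -
    note [measurable] = T'_meas[OF G]
    have "(\<integral>\<^sup>+x. h G x * indicator B x \<partial>base E)
        = (\<integral>\<^sup>+x. ennreal (norm (restr f B x)) * ennreal (norm (T' (restr g G) x)) \<partial>base E)"
      by (intro nn_integral_cong) (simp add: h_def norm_restr indicator_def)
    also have "\<dots> \<le> ennreal (nrm E (restr f B)) * koethe_norm E (T' (restr g G))"
      unfolding koethe_norm_def using B f by (intro E.koethe_hoelder E.restr_mem) auto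
    also have "\<dots> \<le> ennreal (nrm E (restr f B)) * (ennreal D * ennreal (koethe_nrm F (restr g G)))"
      using D(2)[OF restr_g[OF G]] F.ennreal_koethe_nrm[OF restr_g[OF G]] by (intro mult_left_mono) auto
    also have "\<dots> = ennreal ((D * nrm E (restr f B)) * koethe_nrm F (restr g G))"
      using D(1) F.koethe_nrm_nonneg E.nrm_nonneg[OF E.restr_mem[OF f B]]
      by (simp add: mult_ac flip: ennreal_mult)
    also have "\<dots> \<le> ennreal (\<nu> B * \<kappa> G)"
      using \<nu>[OF B] \<kappa>[OF G] D(1) E.nrm_nonneg[OF E.restr_mem[OF f B]] F.koethe_nrm_nonneg \<nu>_nonneg[OF B]
      by (intro ennreal_leI mult_mono) auto
    finally show ?thesis .
  qed
  have A_sets: "A \<alpha> \<in> sets (base F)" if "\<alpha> \<in> Q" for \<alpha> using filt that by (auto simp: filtration_def)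
  have "(\<integral>\<^sup>+x. (SUP \<alpha>\<in>Q. h (A \<alpha>) x) \<partial>base E) \<le> ennreal (K * \<nu> (space (base E)) * c)"
  proof (rule nn_integral_SUP_finite_subsets)
    fix S assume S: "finite S" "S \<subseteq> Q"
    have "(\<integral>\<^sup>+x. (SUP G\<in>A ` S. h G x) * indicator (space (base E)) x \<partial>base E)
        \<le> ennreal (K * \<nu> (space (base E)) * c)"
    proof (rule chain_maximal_bound[OF h_meas h_sub h_bound])
      show "G \<subseteq> G' \<or> G' \<subseteq> G" if "G \<in> A ` S" "G' \<in> A ` S" for G G'
        using that filtration_chain[OF filt S(2)] by blast
    qed (use S A_sets c c0 in auto)
    moreover have "(\<integral>\<^sup>+x. (SUP G\<in>A ` S. h G x) * indicator (space (base E)) x \<partial>base E)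
        = (\<integral>\<^sup>+x. (SUP \<alpha>\<in>S. h (A \<alpha>) x) \<partial>base E)"
      by (intro nn_integral_cong) (simp add: image_image)
    ultimately show "(\<integral>\<^sup>+x. (SUP \<alpha>\<in>S. h (A \<alpha>) x) \<partial>base E) \<le> ennreal (K * \<nu> (space (base E)) * c)"
      by simp
  qed (use h_meas A_sets in auto)
  then show ?thesis by (simp add: maximal_op_def h_def SUP_mult_left_ennreal restr_def)
qed

lemma exponents:
  assumes "1 \<le> p" "p < q"
  obtains P r where "p = ennreal P" "1 \<le> P" "1 \<le> r" "1 < q" "conj_exponent q = ennreal r"
    "enn2real (1 / p) = 1 / P" "enn2real (1 / q) = 1 - 1 / r" "1 - 1 / P < 1 / r"
proof -
  have q: "1 < q" using assms by (rule le_less_trans)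
  obtain P where P: "p = ennreal P" "1 \<le> P"
  proof (cases p)
    case (real P)
    then show ?thesis using assms(1) that by simp
  qed (use assms in auto)
  obtain r where r: "1 \<le> r" "conj_exponent q = ennreal r" "enn2real (1 / q) = 1 - 1 / r"
    "q = \<infinity> \<and> r = 1 \<or> (\<exists>Q>1. q = ennreal Q \<and> 1 / Q = 1 - 1 / r \<and> (r - 1) * Q = r)"
    using conj_exponent_gt_1[OF q] .
  have "1 - 1 / r < 1 / P" using r(4)
  proof
    assume "q = \<infinity> \<and> r = 1"
    then show ?thesis using P by simp
  next
    assume "\<exists>Q>1. q = ennreal Q \<and> 1 / Q = 1 - 1 / r \<and> (r - 1) * Q = r"
    then obtain Q where Q: "1 < Q" "q = ennreal Q" "1 / Q = 1 - 1 / r" by blast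
    have "P < Q" using assms(2) P Q by (simp add: ennreal_less_iff)
    then have "1 / Q < 1 / P" using P by (intro divide_strict_left_mono) auto
    then show ?thesis using Q by simp
  qed
  then show ?thesis using that[OF P r(1) q r(2) _ r(3)] conj_exponent_ratio(3)[OF P(2,1)] by simp
qed

text \<open>
  By duality, a bound for $(T')^*$ amounts to a bound for the integral of $|f|\,(T')^*g$ for each
  fixed pair $f$, $g$. The set functions may therefore depend on $f$ and $g$, but the final
  constant must not. Here \<open>D\<close> stands for the norm of $T'$.
\<close>
lemma maximal_op_norm_le:
  fixes E :: "('a, 'k::{real_normed_field, banach, second_countable_topology}) function_space"
    and F :: "('b, 'k) function_space" and A :: "nat \<Rightarrow> 'b set"
  assumes EF: "banach_function_lattice E" "banach_function_lattice F"
    and T: "bounded_linear_map_ae E F T" and T': "is_koethe_dual_map E F T T'"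
    and filt: "filtration (base F) Q r A" and C: "0 \<le> C"
    and data: "\<And>D f g. 0 \<le> D \<Longrightarrow> f \<in> elems E \<Longrightarrow> nrm E f \<le> 1 \<Longrightarrow> g \<in> koethe_dual F \<Longrightarrow>
      \<exists>\<nu> \<kappa> \<theta> \<eta> K c. balanced_set_functions (base E) (base F) \<nu> \<kappa> \<theta> \<eta> K \<and>
        (\<forall>B\<in>sets (base E). D * nrm E (restr f B) \<le> \<nu> B) \<and>
        (\<forall>G\<in>sets (base F). koethe_nrm F (restr g G) \<le> \<kappa> G \<and> \<kappa> G \<le> c) \<and>
        K * \<nu> (space (base E)) * c \<le> C * D * koethe_nrm F g"
  shows "koethe_op_norm F E (maximal_op T' Q A) \<le> ennreal C * koethe_op_norm_linear F E T'"
proof -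
  interpret F: banach_function_lattice F by fact
  have fin: "koethe_op_norm_linear F E T' < \<infinity>" using koethe_dual_map_bounded[OF EF T T'] .
  then obtain D where D: "0 \<le> D" "koethe_op_norm_linear F E T' = ennreal D"
    by (cases "koethe_op_norm_linear F E T'") auto
  have lin: "linear_map_ae (base F) (koethe_dual F) (base E) (koethe_dual E) T'"
    using T' by (simp add: is_koethe_dual_map_def)
  have D_bound: "koethe_norm E (T' g) \<le> ennreal D * koethe_norm F g" if "g \<in> koethe_dual F" for g
    using koethe_op_norm_bound[OF that fin] unfolding D(2) koethe_norm_def by simp
  have "koethe_op_norm F E (maximal_op T' Q A) \<le> ennreal C * ennreal D"
  proof (rule koethe_op_norm_le)
    fix g assume g: "g \<in> koethe_dual F"
    show "koethe_norm_ext E (maximal_op T' Q A g) \<le> ennreal C * ennreal D * koethe_norm F g"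
      unfolding koethe_norm_ext_def
    proof (rule SUP_least)
      fix f assume "f \<in> {f \<in> elems E. nrm E f \<le> 1}"
      then have f: "f \<in> elems E" "nrm E f \<le> 1" by auto
      obtain \<nu> \<kappa> \<theta> \<eta> K c where bal: "balanced_set_functions (base E) (base F) \<nu> \<kappa> \<theta> \<eta> K"
        and \<nu>: "\<And>B. B \<in> sets (base E) \<Longrightarrow> D * nrm E (restr f B) \<le> \<nu> B"
        and \<kappa>: "\<And>G. G \<in> sets (base F) \<Longrightarrow> koethe_nrm F (restr g G) \<le> \<kappa> G"
          "\<And>G. G \<in> sets (base F) \<Longrightarrow> \<kappa> G \<le> c"
        and le: "K * \<nu> (space (base E)) * c \<le> C * D * koethe_nrm F g"
        using data[OF D(1) f g] by blast
      have "(\<integral>\<^sup>+x. ennreal (norm (f x)) * maximal_op T' Q A g x \<partial>base E)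
          \<le> ennreal (K * \<nu> (space (base E)) * c)"
        using maximal_op_bound[OF EF lin D(1) D_bound filt g f(1) bal \<nu> \<kappa>] .
      also have "\<dots> \<le> ennreal (C * D * koethe_nrm F g)" by (rule ennreal_leI[OF le])
      also have "\<dots> = ennreal C * ennreal D * koethe_norm F g"
        using C D(1) by (simp add: ennreal_mult F.koethe_nrm_nonneg F.ennreal_koethe_nrm[OF g])
      finally show "(\<integral>\<^sup>+x. ennreal (norm (f x)) * maximal_op T' Q A g x \<partial>base E)
          \<le> ennreal C * ennreal D * koethe_norm F g" .
    qed
  qed
  then show ?thesis by (simp add: D(2))
qed

section \<open>The two maximal inequalities\<close>

lemma sum_lessThan_2: "(\<Sum>j<2. h j) = h 0 + h (1::nat)"
  by (simp add: numeral_2_eq_2)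

context banach_function_lattice
begin

lemma two_piece_lower_estimate:
  assumes "1 \<le> p" "lower_const_n (ennreal p) 2 E \<le> ennreal l" "0 \<le> l" "f \<in> elems E"
    and "B \<in> sets (base E)" "B' \<in> sets (base E)" "B \<inter> B' = {}"
  shows "nrm E (restr f B) powr p + nrm E (restr f B') powr p \<le> (l * nrm E (restr f (B \<union> B'))) powr p"
proof -
  have "(B \<union> B') \<inter> B = B" "(B \<union> B') \<inter> B' = B'" by auto
  then show ?thesis
    using lower_estimate_restr[OF assms(1-3) restr_mem[OF assms(4)], of "B \<union> B'" "\<lambda>j. if j = 0 then B else B'"]
      assms(5-7)
    by (auto simp: sum_lessThan_2 restr_restr Int_commute)
qed

lemma two_piece_koethe_dual_lower_estimate:
  assumes "1 < q" "1 \<le> r" "conj_exponent q = ennreal r" "upper_const_n q 2 E \<le> ennreal u" "0 \<le> u"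
    and "g \<in> koethe_dual E" "A \<in> sets (base E)" "A' \<in> sets (base E)" "A \<inter> A' = {}"
  shows "koethe_nrm E (restr g A) powr r + koethe_nrm E (restr g A') powr r
    \<le> (u * koethe_nrm E (restr g (A \<union> A'))) powr r"
proof -
  have "(A \<union> A') \<inter> A = A" "(A \<union> A') \<inter> A' = A'" by auto
  then show ?thesis
    using koethe_dual_lower_estimate_restr[OF assms(1-5) koethe_dual_restr[OF assms(6)],
        of "A \<union> A'" "\<lambda>j. if j = 0 then A else A'"] assms(7-9)
    by (auto simp: sum_lessThan_2 restr_restr Int_commute)
qed

end

text \<open>
  The smallness hypothesis is also met when one constant is $0$ and the other one $\infty$. A
  vanishing constant means that all restrictions of $f$, respectively of $g$, have norm $0$. Set
  functions that vanish on one side are balanced with $K = 1$.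
\<close>
theorem maximal_bound_of_two_piece_estimates:
  fixes E :: "('a, 'k::{real_normed_field, banach, second_countable_topology}) function_space"
    and F :: "('b, 'k) function_space"
  assumes EF: "banach_function_lattice E" "banach_function_lattice F"
    and pq: "1 \<le> p" "p < q"
    and small: "lower_const_n p 2 E * upper_const_n q 2 F
          < ennreal (2 powr (enn2real (1 / p) - enn2real (1 / q)))"
  obtains C :: real where "0 \<le> C"
    "\<And>T T' (Q :: nat set) r A. bounded_linear_map_ae E F T \<Longrightarrow> is_koethe_dual_map E F T T' \<Longrightarrow>
      filtration (base F) Q r A \<Longrightarrow>
      koethe_op_norm F E (maximal_op T' Q A) \<le> ennreal C * koethe_op_norm_linear F E T'"
proof -
  interpret E: banach_function_lattice E by fact
  interpret F: banach_function_lattice F by fact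
  obtain P r where P: "p = ennreal P" "1 \<le> P" and r: "1 \<le> r" "1 < q" "conj_exponent q = ennreal r"
    and ex: "enn2real (1 / p) = 1 / P" "enn2real (1 / q) = 1 - 1 / r" "1 - 1 / P < 1 / r"
    using exponents[OF pq] by metis
  consider (l0) "lower_const_n p 2 E = 0" | (u0) "upper_const_n q 2 F = 0"
    | (pos) l u where "lower_const_n p 2 E = ennreal l" "0 < l" "upper_const_n q 2 F = ennreal u" "0 < u"
  proof (cases "lower_const_n p 2 E"; cases "upper_const_n q 2 F")
    fix l u :: real assume "0 \<le> l" "lower_const_n p 2 E = ennreal l" "0 \<le> u" "upper_const_n q 2 F = ennreal u"
    then show ?thesis using that by (cases "l = 0"; cases "u = 0") auto
  qed (use small that in \<open>auto simp: ennreal_mult_top ennreal_top_mult split: if_splits\<close>)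
  then show ?thesis
  proof cases
    case l0
    have le: "lower_const_n (ennreal P) 2 E \<le> ennreal 0" using l0 P by simp
    have zero: "nrm E (restr f B) = 0" if "f \<in> elems E" "B \<in> sets (base E)" for f B
    proof -
      have "nrm E (restr f B) powr P + nrm E (restr f {}) powr P \<le> 0"
        using E.two_piece_lower_estimate[OF P(2) le _ that(1,2), of "{}"] by simp
      moreover have "0 \<le> nrm E (restr f B) powr P" "0 \<le> nrm E (restr f {}) powr P" by simp_all
      ultimately have "nrm E (restr f B) powr P = 0" by linarith
      then show ?thesis by simp
    qed
    show ?thesis
    proof (rule that[of 1], simp, rule maximal_op_norm_le[OF EF])
      fix D :: real and f g assume D: "0 \<le> D" and f: "f \<in> elems E" and g: "g \<in> koethe_dual F"
      have "balanced_set_functions (base E) (base F) (\<lambda>_. 0) (\<lambda>G. koethe_nrm F (restr g G)) 1 1 1"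
        by unfold_locales (use g in \<open>auto simp: F.koethe_nrm_nonneg F.koethe_nrm_restr_empty intro!: F.koethe_nrm_restr_mono\<close>)
      then show "\<exists>\<nu> \<kappa> \<theta> \<eta> K c. balanced_set_functions (base E) (base F) \<nu> \<kappa> \<theta> \<eta> K \<and>
        (\<forall>B\<in>sets (base E). D * nrm E (restr f B) \<le> \<nu> B) \<and>
        (\<forall>G\<in>sets (base F). koethe_nrm F (restr g G) \<le> \<kappa> G \<and> \<kappa> G \<le> c) \<and>
        K * \<nu> (space (base E)) * c \<le> 1 * D * koethe_nrm F g"
        using zero[OF f] F.koethe_nrm_restr_le[OF g] D F.koethe_nrm_nonneg
        by (intro exI conjI) (assumption, auto)
    qed auto
  next
    case u0
    have le: "upper_const_n q 2 F \<le> ennreal 0" using u0 by simp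
    have zero: "koethe_nrm F (restr g G) = 0" if "g \<in> koethe_dual F" "G \<in> sets (base F)" for g G
      using F.two_piece_koethe_dual_lower_estimate[OF r(2,1,3) le _ that(1,2), of "{}"] by (simp add: F.koethe_nrm_restr_empty)
    show ?thesis
    proof (rule that[of 1], simp, rule maximal_op_norm_le[OF EF])
      fix D :: real and f g assume D: "0 \<le> D" and f: "f \<in> elems E" and g: "g \<in> koethe_dual F"
      have "balanced_set_functions (base E) (base F) (\<lambda>B. D * nrm E (restr f B)) (\<lambda>_. 0) 0 0 1"
        by unfold_locales (use f D in \<open>auto intro!: E.nrm_nonneg E.restr_mem E.nrm_restr_mono mult_left_mono mult_nonneg_nonneg\<close>)
      then show "\<exists>\<nu> \<kappa> \<theta> \<eta> K c. balanced_set_functions (base E) (base F) \<nu> \<kappa> \<theta> \<eta> K \<and>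
        (\<forall>B\<in>sets (base E). D * nrm E (restr f B) \<le> \<nu> B) \<and>
        (\<forall>G\<in>sets (base F). koethe_nrm F (restr g G) \<le> \<kappa> G \<and> \<kappa> G \<le> c) \<and>
        K * \<nu> (space (base E)) * c \<le> 1 * D * koethe_nrm F g"
        using zero[OF g] D F.koethe_nrm_nonneg[of g]
        by (intro exI[of _ 0] exI conjI) (assumption, auto)
    qed auto
  next
    case pos
    define b where "b = l * u * 2 powr (1 - 1/P - 1/r)"
    have "ennreal (l * u) < ennreal (2 powr (1 / P - (1 - 1 / r)))"
      using small pos ex by (simp add: ennreal_mult)
    then have "l * u < 2 powr (1 / P - (1 - 1 / r))"
      using pos by (subst (asm) ennreal_less_iff) auto
    then have "b < 2 powr (1 / P - (1 - 1 / r)) * 2 powr (1 - 1/P - 1/r)"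
      unfolding b_def by (intro mult_strict_right_mono) auto
    then have b: "b < 1" by (simp flip: powr_add)
    have l: "lower_const_n (ennreal P) 2 E \<le> ennreal l" "0 \<le> l" using pos P by auto
    have u: "upper_const_n q 2 F \<le> ennreal u" "0 \<le> u" using pos by auto
    have C: "0 \<le> 1 / (1 - b)" using b by simp
    show ?thesis
    proof (rule that[OF C], rule maximal_op_norm_le[OF EF])
      fix D :: real and f g
      assume D: "0 \<le> D" and f: "f \<in> elems E" "nrm E f \<le> 1" and g: "g \<in> koethe_dual F"
      have bal: "balanced_set_functions (base E) (base F) (\<lambda>B. D * nrm E (restr f B))
          (\<lambda>G. koethe_nrm F (restr g G)) (u / 2 powr (1/r)) (u / 2 powr (1/r)) (1 / (1 - b))"
        unfolding b_def
      proof (rule balanced_of_two_piece_estimates[OF P(2) r(1) D l(2) u(2)])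
        show "l * u * 2 powr (1 - 1/P - 1/r) < 1" using b by (simp add: b_def)
      qed (use f g E.two_piece_lower_estimate[OF P(2) l f(1)]
            F.two_piece_koethe_dual_lower_estimate[OF r(2,1,3) u g]
          in \<open>auto intro!: E.nrm_nonneg E.restr_mem E.nrm_restr_mono F.koethe_nrm_restr_mono
              simp: F.koethe_nrm_nonneg F.koethe_nrm_restr_empty\<close>)
      have "nrm E (restr f (space (base E))) \<le> 1"
        using E.nrm_restr_le[OF f(1), of "space (base E)"] f(2) by simp
      then have "1 / (1 - b) * D * koethe_nrm F g * nrm E (restr f (space (base E))) \<le> 1 / (1 - b) * D * koethe_nrm F g * 1"
        using C D F.koethe_nrm_nonneg by (intro mult_left_mono) auto
      then have "1 / (1 - b) * (D * nrm E (restr f (space (base E)))) * koethe_nrm F g \<le> 1 / (1 - b) * D * koethe_nrm F g"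
        by (simp add: mult_ac)
      then show "\<exists>\<nu> \<kappa> \<theta> \<eta> K c. balanced_set_functions (base E) (base F) \<nu> \<kappa> \<theta> \<eta> K \<and>
        (\<forall>B\<in>sets (base E). D * nrm E (restr f B) \<le> \<nu> B) \<and>
        (\<forall>G\<in>sets (base F). koethe_nrm F (restr g G) \<le> \<kappa> G \<and> \<kappa> G \<le> c) \<and>
        K * \<nu> (space (base E)) * c \<le> 1 / (1 - b) * D * koethe_nrm F g"
        using bal F.koethe_nrm_restr_le[OF g] by (intro exI conjI) (assumption, auto)
    qed (use C in auto)
  qed
qed

text \<open>
  Passing to the superadditive envelopes of $\|f\chi_B\|^p$ and $\|g\chi_A\|^{q'}$ makes the
  constants of the estimates $1$ inside the recursion. They enter only once, in the comparison of
  the envelopes with the original norms.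
\<close>
theorem maximal_bound_of_estimates:
  fixes E :: "('a, 'k::{real_normed_field, banach, second_countable_topology}) function_space"
    and F :: "('b, 'k) function_space" and A :: "nat \<Rightarrow> 'b set"
  assumes EF: "banach_function_lattice E" "banach_function_lattice F"
    and pq: "1 \<le> p" "p < q" and est: "lower_estimate p E" "upper_estimate q F"
    and T: "bounded_linear_map_ae E F T" "is_koethe_dual_map E F T T'" "filtration (base F) Q rel A"
  shows "koethe_op_norm F E (maximal_op T' Q A)
           \<le> ennreal (2 powr enn2real (1 / conj_exponent p) /
                 (1 - (2 powr enn2real (conj_exponent q / conj_exponent p) - 1)
                        powr enn2real (1 / conj_exponent q)))
             * lower_const p E * upper_const q F * koethe_op_norm_linear F E T'"
proof -
  interpret E: banach_function_lattice E by fact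
  interpret F: banach_function_lattice F by fact
  obtain P r where P: "p = ennreal P" "1 \<le> P" and r: "1 \<le> r" "1 < q" "conj_exponent q = ennreal r"
    and ex: "1 - 1 / P < 1 / r"
    using exponents[OF pq] by metis
  obtain l where l: "0 \<le> l" "lower_const p E = ennreal l"
    using est(1) by (cases "lower_const p E") (auto simp: lower_estimate_def)
  obtain u where u: "0 \<le> u" "upper_const q F = ennreal u"
    using est(2) by (cases "upper_const q F") (auto simp: upper_estimate_def)
  define a where "a = 2 powr (1 - 1/P)"
  define c where "c = (2 powr (r * (1 - 1/P)) - 1) powr (1/r)"
  \<comment> \<open>the sign of the constant depends only on the exponents, so zero set functions will do\<close>
  have K: "0 \<le> a / (1 - c)"
    unfolding a_def c_def
    by (rule balanced_of_superadditive(2)[OF P(2) r(1) ex order_refl, of "count_space {}" "\<lambda>_. 0" "count_space {}" "\<lambda>_. 0"]) auto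
  have "1 / conj_exponent q = ennreal (1 / r)" using r by (simp add: divide_ennreal flip: ennreal_1)
  then have "enn2real (1 / conj_exponent q) = 1 / r" using r by simp
  then have const: "2 powr enn2real (1 / conj_exponent p) /
        (1 - (2 powr enn2real (conj_exponent q / conj_exponent p) - 1) powr enn2real (1 / conj_exponent q)) = a / (1 - c)"
    using conj_exponent_ratio(1)[OF P(2,1)] conj_exponent_ratio(2)[OF P(2,1), of r] r by (simp add: a_def c_def)
  have "koethe_op_norm F E (maximal_op T' Q A) \<le> ennreal (a / (1 - c) * l * u) * koethe_op_norm_linear F E T'"
  proof (rule maximal_op_norm_le[OF EF T])
    fix D :: real and f g
    assume D: "0 \<le> D" and f: "f \<in> elems E" "nrm E f \<le> 1" and g: "g \<in> koethe_dual F"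
    define \<nu>0 where "\<nu>0 = superadditive_envelope (base E) (\<lambda>B. nrm E (restr f B) powr P)"
    define \<kappa>0 where "\<kappa>0 = superadditive_envelope (base F) (\<lambda>G. koethe_nrm F (restr g G) powr r)"
    interpret \<nu>: bounded_on_pieces "base E" "\<lambda>B. nrm E (restr f B) powr P" "(l * nrm E f) powr P"
      using l P by (intro E.bounded_on_pieces_nrm f) auto
    interpret \<kappa>: bounded_on_pieces "base F" "\<lambda>G. koethe_nrm F (restr g G) powr r" "(u * koethe_nrm F g) powr r"
      using u r by (intro F.bounded_on_pieces_koethe_nrm g) auto
    have \<nu>0: "0 \<le> \<nu>0 B" for B by (simp add: \<nu>0_def \<nu>.envelope_nonneg)
    have \<kappa>0: "0 \<le> \<kappa>0 G" for G by (simp add: \<kappa>0_def \<kappa>.envelope_nonneg)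
    have bal: "balanced_set_functions (base E) (base F) (\<lambda>B. D * \<nu>0 B powr (1/P)) (\<lambda>G. \<kappa>0 G powr (1/r))
        (1/a) (c/a) (a / (1 - c))"
      unfolding a_def c_def
      by (rule balanced_of_superadditive(1)[OF P(2) r(1) ex D])
         (auto simp: \<nu>0 \<kappa>0, auto simp: \<nu>0_def \<kappa>0_def \<kappa>.envelope_empty
           intro: \<nu>.envelope_superadditive \<kappa>.envelope_superadditive)
    have \<nu>_ge: "D * nrm E (restr f B) \<le> D * \<nu>0 B powr (1/P)" if B: "B \<in> sets (base E)" for B
    proof -
      have "(nrm E (restr f B) powr P) powr (1/P) \<le> \<nu>0 B powr (1/P)"
        by (rule powr_mono2[rotated 2]) (use P B in \<open>auto simp: \<nu>0_def intro: \<nu>.envelope_ge\<close>)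
      then show ?thesis
        using P D E.nrm_nonneg[OF E.restr_mem[OF f(1) B]] by (intro mult_left_mono) (auto simp: powr_powr)
    qed
    have \<kappa>_ge: "koethe_nrm F (restr g G) \<le> \<kappa>0 G powr (1/r)" if G: "G \<in> sets (base F)" for G
    proof -
      have "(koethe_nrm F (restr g G) powr r) powr (1/r) \<le> \<kappa>0 G powr (1/r)"
        by (rule powr_mono2[rotated 2]) (use r G in \<open>auto simp: \<kappa>0_def intro: \<kappa>.envelope_ge\<close>)
      then show ?thesis using r F.koethe_nrm_nonneg by (simp add: powr_powr)
    qed
    have \<kappa>_le: "\<kappa>0 G powr (1/r) \<le> u * koethe_nrm F g" for G
    proof -
      have "\<kappa>0 G powr (1/r) \<le> ((u * koethe_nrm F g) powr r) powr (1/r)"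
        by (rule powr_mono2[rotated 2]) (use r \<kappa>0 in \<open>auto simp: \<kappa>0_def intro: \<kappa>.envelope_bound\<close>)
      then show ?thesis using r u F.koethe_nrm_nonneg by (simp add: powr_powr)
    qed
    have "\<nu>0 (space (base E)) powr (1/P) \<le> ((l * nrm E f) powr P) powr (1/P)"
      by (rule powr_mono2[rotated 2]) (use P \<nu>0 in \<open>auto simp: \<nu>0_def intro: \<nu>.envelope_bound\<close>)
    also have "\<dots> = l * nrm E f" using P l E.nrm_nonneg[OF f(1)] by (simp add: powr_powr)
    also have "\<dots> \<le> l" using f l by (simp add: mult_left_le)
    finally have "a / (1 - c) * D * (u * koethe_nrm F g) * \<nu>0 (space (base E)) powr (1/P)
        \<le> a / (1 - c) * D * (u * koethe_nrm F g) * l"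
      using K D u F.koethe_nrm_nonneg by (intro mult_left_mono mult_nonneg_nonneg) auto
    then have "a / (1 - c) * (D * \<nu>0 (space (base E)) powr (1/P)) * (u * koethe_nrm F g)
        \<le> a / (1 - c) * l * u * D * koethe_nrm F g" by (simp add: mult_ac)
    then show "\<exists>\<nu> \<kappa> \<theta> \<eta> K k. balanced_set_functions (base E) (base F) \<nu> \<kappa> \<theta> \<eta> K \<and>
        (\<forall>B\<in>sets (base E). D * nrm E (restr f B) \<le> \<nu> B) \<and>
        (\<forall>G\<in>sets (base F). koethe_nrm F (restr g G) \<le> \<kappa> G \<and> \<kappa> G \<le> k) \<and>
        K * \<nu> (space (base E)) * k \<le> a / (1 - c) * l * u * D * koethe_nrm F g"
      using bal \<nu>_ge \<kappa>_ge \<kappa>_le by (intro exI conjI) (assumption, auto)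
  qed (intro mult_nonneg_nonneg K l(1) u(1))
  also have "ennreal (a / (1 - c) * l * u) = ennreal (a / (1 - c)) * ennreal l * ennreal u"
    by (simp only: ennreal_mult mult_nonneg_nonneg K l(1) u(1))
  finally show ?thesis unfolding const l(2) u(2) .
qed

theorem corollary6p1:
  fixes E :: "('a, 'k::{real_normed_field, banach, second_countable_topology}) function_space"
    and F :: "('b, 'k) function_space"
  assumes "sigma_finite_measure (base E)" and "complete_measure (base E)"
    and "sigma_finite_measure (base F)" and "complete_measure (base F)"
    and "banach_function_lattice E" and "weak_fatou E"
    and "banach_function_lattice F" and "weak_fatou F"
  shows
    "(\<forall>p q :: ennreal. 1 \<le> p \<and> p < q \<and>
        lower_const_n p 2 E * upper_const_n q 2 F
          < ennreal (2 powr (enn2real (1 / p) - enn2real (1 / q))) \<longrightarrow>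
        (\<exists>C :: real. 0 \<le> C \<and>
          (\<forall>T T' (Q :: nat set) r A.
             bounded_linear_map_ae E F T \<and> is_koethe_dual_map E F T T' \<and>
             filtration (base F) Q r A \<longrightarrow>
             koethe_op_norm F E (maximal_op T' Q A)
               \<le> ennreal C * koethe_op_norm_linear F E T')))
     \<and>
     (\<forall>p q :: ennreal. 1 \<le> p \<and> p < q \<and> lower_estimate p E \<and> upper_estimate q F \<longrightarrow>
        (\<forall>T T' (Q :: nat set) r A.
           bounded_linear_map_ae E F T \<and> is_koethe_dual_map E F T T' \<and>
           filtration (base F) Q r A \<longrightarrow>
           koethe_op_norm F E (maximal_op T' Q A)
             \<le> ennreal (2 powr enn2real (1 / conj_exponent p) /
                   (1 - (2 powr enn2real (conj_exponent q / conj_exponent p) - 1)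
                          powr enn2real (1 / conj_exponent q)))
               * lower_const p E * upper_const q F * koethe_op_norm_linear F E T'))"
proof (intro conjI allI impI)
  fix p q :: ennreal
  assume "1 \<le> p \<and> p < q \<and> lower_const_n p 2 E * upper_const_n q 2 F
    < ennreal (2 powr (enn2real (1 / p) - enn2real (1 / q)))"
  then show "\<exists>C :: real. 0 \<le> C \<and> (\<forall>T T' (Q :: nat set) r A.
      bounded_linear_map_ae E F T \<and> is_koethe_dual_map E F T T' \<and> filtration (base F) Q r A \<longrightarrow>
      koethe_op_norm F E (maximal_op T' Q A) \<le> ennreal C * koethe_op_norm_linear F E T')"
    using maximal_bound_of_two_piece_estimates[OF assms(5,7), of p q] by metis
next
  fix p q :: ennreal and T T' r A and Q :: "nat set"
  assume "1 \<le> p \<and> p < q \<and> lower_estimate p E \<and> upper_estimate q F"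
    and "bounded_linear_map_ae E F T \<and> is_koethe_dual_map E F T T' \<and> filtration (base F) Q r A"
  then show "koethe_op_norm F E (maximal_op T' Q A)
      \<le> ennreal (2 powr enn2real (1 / conj_exponent p) /
            (1 - (2 powr enn2real (conj_exponent q / conj_exponent p) - 1)
                   powr enn2real (1 / conj_exponent q)))
        * lower_const p E * upper_const q F * koethe_op_norm_linear F E T'"
    using maximal_bound_of_estimates[OF assms(5,7)] by blast
qed

end
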